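(* Let $n\ge 5$. For generic parameters $t_1<\dots<t_n$ in $\mathbb{R}$, every $2$-triangulation of the $n$-gon is isostatic in dimension $4$ for the points $p_i=(t_i,t_i^2,t_i^3,t_i^4)\in\mathbb{R}^4$ on the moment curve; that is, for every $2$-triangulation $T\subset\binom{[n]}{2}$, the rows of the bar-and-joint rigidity matrix $R(p_1,\dots,p_n)$ indexed by $T$ form a basis of the row space of $R(p_1,\dots,p_n)$.
   Context: An edge is an element of $\binom{[n]}{2}$. Two disjoint edges $\{i,j\},\{a,b\}$ with $i<j$, $a<b$ cross if $i<a<j<b$ or $a<i<b<j$. A $2$-triangulation of the $n$-gon is an inclusion-maximal subset of $\binom{[n]}{2}$ that contains no three pairwise crossing edges. For points $p_1,\dots,p_n\in\mathbb{R}^d$, the bar-and-joint rigidity matrix $R(p_1,\dots,p_n)$ is the $\binom n2\times nd$ matrix with one row per edge $\{i,j\}$ and one block of $d$ columns per vertex; the row of $\{i,j\}$ has $p_i-p_j$ in block $i$, $p_j-p_i$ in block $j$ and zeros elsewhere. "Generic" means: for all $(t_1,\dots,t_n)$ outside the zero set of some nonzero real polynomial in $n$ variables. *)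

theory Defs
  imports
    "HOL-Analysis.Analysis"
    "HOL-Library.Function_Algebras"
    "HOL-Library.Poly_Mapping"
begin

instantiation "fun" :: (type, real_vector) real_vector
begin

definition "scaleR_fun c f = (\<lambda>x. c *\<^sub>R f x)"

instance
  by standard (auto simp: scaleR_fun_def fun_eq_iff algebra_simps)

end


definition edges :: "nat \<Rightarrow> nat set set" where
  "edges n = {e. e \<subseteq> {1..n} \<and> card e = 2}"

definition cross :: "nat set \<Rightarrow> nat set \<Rightarrow> bool" where
  "cross e f \<longleftrightarrow> (\<exists>i j a b. e = {i, j} \<and> f = {a, b} \<and> e \<inter> f = {} \<and> i < j \<and> a < b \<and>
     (i < a \<and> a < j \<and> j < b \<or> a < i \<and> i < b \<and> b < j))"

definition three_crossing_free :: "nat set set \<Rightarrow> bool" where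
  "three_crossing_free T \<longleftrightarrow>
     \<not> (\<exists>e\<in>T. \<exists>f\<in>T. \<exists>g\<in>T. cross e f \<and> cross e g \<and> cross f g)"

definition two_triangulation :: "nat \<Rightarrow> nat set set \<Rightarrow> bool" where
  "two_triangulation n T \<longleftrightarrow>
     T \<subseteq> edges n \<and> three_crossing_free T \<and>
     (\<forall>S. S \<subseteq> edges n \<and> three_crossing_free S \<and> T \<subseteq> S \<longrightarrow> S = T)"


text \<open>
  The entry of the rigidity matrix in the row of the edge \<open>e\<close> and in the column given by
  the vertex \<open>v\<close> and the coordinate \<open>k\<close>. For \<open>v \<in> e\<close>, \<open>the_elem (e - {v})\<close> is the
  other endpoint. Rows of edges in \<open>edges n\<close> vanish in the columns of all \<open>v \<notin> {1..n}\<close>, so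
  these columns do not affect linear dependence among the rows.
\<close>

definition rigidity_matrix :: "(nat \<Rightarrow> real ^ 'd) \<Rightarrow> nat set \<Rightarrow> nat \<times> 'd \<Rightarrow> real" where
  "rigidity_matrix p e = (\<lambda>(v, k). if v \<in> e then (p v - p (the_elem (e - {v}))) $ k else 0)"

lemma rigidity_matrix_edge:
  assumes "i \<noteq> j"
  shows "rigidity_matrix p {i, j} (i, k) = (p i - p j) $ k"
    and "rigidity_matrix p {i, j} (j, k) = (p j - p i) $ k"
    and "v \<notin> {i, j} \<Longrightarrow> rigidity_matrix p {i, j} (v, k) = 0"
proof -
  have "{i, j} - {i} = {j}" "{i, j} - {j} = {i}"
    using assms by auto
  then show "rigidity_matrix p {i, j} (i, k) = (p i - p j) $ k"
    and "rigidity_matrix p {i, j} (j, k) = (p j - p i) $ k"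
    and "v \<notin> {i, j} \<Longrightarrow> rigidity_matrix p {i, j} (v, k) = 0"
    by (auto simp: rigidity_matrix_def)
qed

definition row_space :: "nat \<Rightarrow> (nat \<Rightarrow> real ^ 'd) \<Rightarrow> (nat \<times> 'd \<Rightarrow> real) set" where
  "row_space n p = span (rigidity_matrix p ` edges n)"

text \<open>Injectivity: the basis is the family of rows indexed by \<open>T\<close>, not just the set of rows.\<close>

definition isostatic :: "nat \<Rightarrow> (nat \<Rightarrow> real ^ 'd) \<Rightarrow> nat set set \<Rightarrow> bool" where
  "isostatic n p T \<longleftrightarrow>
     T \<subseteq> edges n \<and>
     inj_on (rigidity_matrix p) T \<and>
     independent (rigidity_matrix p ` T) \<and>
     span (rigidity_matrix p ` T) = row_space n p"

definition moment_curve :: "real \<Rightarrow> real ^ 4" where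
  "moment_curve t = vector [t, t ^ 2, t ^ 3, t ^ 4]"

lemma moment_curve_nth:
  "moment_curve t $ 1 = t" "moment_curve t $ 2 = t ^ 2"
  "moment_curve t $ 3 = t ^ 3" "moment_curve t $ 4 = t ^ 4"
  by (simp_all add: moment_curve_def vector_def)


text \<open>
  A real polynomial is a finitely supported map from monomials to coefficients, a monomial being
  a finitely supported map from indices of variables to exponents.
\<close>

type_synonym real_mpoly = "(nat \<Rightarrow>\<^sub>0 nat) \<Rightarrow>\<^sub>0 real"

definition vars_in :: "nat set \<Rightarrow> real_mpoly \<Rightarrow> bool" where
  "vars_in V P \<longleftrightarrow> (\<forall>m\<in>Poly_Mapping.keys P. Poly_Mapping.keys m \<subseteq> V)"

definition eval_mpoly :: "(nat \<Rightarrow> real) \<Rightarrow> real_mpoly \<Rightarrow> real" where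
  "eval_mpoly t P =
     (\<Sum>m\<in>Poly_Mapping.keys P. Poly_Mapping.lookup P m *
        (\<Prod>i\<in>Poly_Mapping.keys m. t i ^ Poly_Mapping.lookup m i))"

text \<open>
  \<open>\<Phi>\<close> holds for generic \<open>t\<^sub>1, \<dots>, t\<^sub>n\<close>. Only the values of \<open>t\<close> on \<open>{1..n}\<close> are meant
  to matter for \<open>\<Phi> t\<close>.
\<close>

definition for_generic :: "nat \<Rightarrow> ((nat \<Rightarrow> real) \<Rightarrow> bool) \<Rightarrow> bool" where
  "for_generic n \<Phi> \<longleftrightarrow>
     (\<exists>P. P \<noteq> 0 \<and> vars_in {1..n} P \<and> (\<forall>t. eval_mpoly t P \<noteq> 0 \<longrightarrow> \<Phi> t))"

end

theory Submission
  imports Defs "HOL-Computational_Algebra.Polynomial"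
begin

text \<open>
  The proof is an induction on the number of vertices in which two consecutive vertices of the
  polygon are merged. On the combinatorial side this turns a 2-triangulation of the
  \<open>(m + 1)\<close>-gon into one of the \<open>m\<close>-gon with four edges less; on the rigidity side the inverse
  operation is a vertex split, which preserves independence of the rows.

  Combinatorics. Every 2-triangulation contains an edge \<open>{i, i + 3}\<close>
  (\<open>ear_exists\<close>): replacing a shortest edge of length at least 3 by one of length exactly 3 that
  starts at the same vertex creates no new 3-crossing. Put \<open>a = i + 1\<close> and merge \<open>a\<close> with
  \<open>a + 1\<close>. Since the edge \<open>{a - 1, a + 2}\<close> crosses every edge from \<open>a\<close> or \<open>a + 1\<close> to a vertex
  outside \<open>{a - 1, \<dots>, a + 2}\<close>, two such edges with different starting points never cross each
  other. Walking around the polygon from \<open>a + 2\<close> to \<open>a - 1\<close>, all such neighbours of \<open>a + 1\<close>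
  therefore come before all those of \<open>a\<close>, with at most one vertex in common; maximality
  forces exactly one common vertex, the apex \<open>c\<close> (\<open>apex_exists\<close>). So \<open>a\<close> and \<open>a + 1\<close> have
  the three common neighbours \<open>a - 1\<close>, \<open>a + 2\<close>, \<open>c\<close>, and merging loses the edge
  \<open>{a, a + 1}\<close> and three duplicates. A crossing between images comes from a crossing between
  originals, so the merged set has no 3-crossing. It is maximal because any larger 3-crossing-free
  set can be inflated at \<open>c\<close> to a 3-crossing-free set that contains the original
  2-triangulation (\<open>contracted_maximal\<close>).

  Rigidity. Let the parameters of \<open>a\<close> and \<open>a + 1\<close> coincide, with common value \<open>s\<close>, and replace
  the row of \<open>{a, a + 1}\<close>, divided by the difference of the two parameters, by its limit, which
  is given by the tangent vector of the moment curve at \<open>s\<close>. Adding the columns of \<open>a\<close> and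
  \<open>a + 1\<close> turns a dependence into a dependence for the merged set. The latter is trivial by
  induction, so only edges to the three common neighbours and the edge \<open>{a, a + 1}\<close> can carry
  nonzero coefficients. At the vertex \<open>a\<close> there remains a linear relation in \<open>\<real>\<^sup>4\<close> between a
  tangent vector and three chords of the moment curve through the same point, and these are
  linearly independent (\<open>tangent_chords_independent\<close>). Independence of rows that depend
  polynomially on the parameters is implied by the nonvanishing of one polynomial
  (\<open>independent_family_open\<close>), so it persists for nearby parameters that are pairwise distinct.

  Rank. The induction also gives every 2-triangulation \<open>4 n - 10\<close> edges. On the other hand, the
  \<open>4 n - 10\<close> rows of edges that meet \<open>{1, 2, 3, 4}\<close> span the row space: six points on the moment
  curve in \<open>\<real>\<^sup>4\<close> satisfy an affine dependence with nonzero coefficients \<open>l v\<close>, and the products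
  \<open>l u * l v\<close> form a dependence of the rows of the complete graph on these six vertices
  (\<open>complete_graph_stress\<close>). Hence independent rows of a 2-triangulation are a basis. As there
  are finitely many 2-triangulations, the product of their polynomials defines the generic set.
\<close>

section \<open>Crossing edges and maximality\<close>

lemma edges_obtain:
  assumes "e \<in> edges n"
  obtains i j where "e = {i, j}" "i < j" "1 \<le> i" "j \<le> n"
proof -
  from assms obtain x y where "e = {x, y}" "x \<noteq> y" "e \<subseteq> {1..n}"
    unfolding edges_def by (auto simp: card_2_iff)
  then show thesis
    using that[of x y] that[of y x] by (cases "x < y") (auto simp: insert_commute)
qed

lemma doubleton_in_edges: "{i, j} \<in> edges n \<longleftrightarrow> i \<noteq> j \<and> i \<in> {1..n} \<and> j \<in> {1..n}"
  by (auto simp: edges_def card_2_iff card_insert_if)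

lemma edge_at:
  assumes "e \<in> edges n" "v \<in> e"
  obtains w where "e = {v, w}" "w \<noteq> v" "w \<in> {1..n}"
proof -
  from assms(1) obtain i j where e: "e = {i, j}" "i < j" "1 \<le> i" "j \<le> n"
    by (rule edges_obtain)
  show thesis
  proof (cases "v = i")
    case True
    then show thesis using e that[of j] by auto
  next
    case False
    then show thesis using e assms(2) that[of i] by (auto simp: insert_commute)
  qed
qed

lemma finite_edges [simp]: "finite (edges n)"
  unfolding edges_def by (rule finite_subset[of _ "Pow {1..n}"]) auto

lemma cross_doubleton:
  assumes "i < j" "k < l"
  shows "cross {i, j} {k, l} \<longleftrightarrow> i < k \<and> k < j \<and> j < l \<or> k < i \<and> i < l \<and> l < j"
proof
  assume "cross {i, j} {k, l}"
  then show "i < k \<and> k < j \<and> j < l \<or> k < i \<and> i < l \<and> l < j"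
    unfolding cross_def by (elim exE conjE) (use assms in \<open>auto simp: doubleton_eq_iff\<close>)
next
  assume "i < k \<and> k < j \<and> j < l \<or> k < i \<and> i < l \<and> l < j"
  then show "cross {i, j} {k, l}"
    unfolding cross_def using assms
    by (intro exI[of _ i] exI[of _ j] exI[of _ k] exI[of _ l]) auto
qed

lemma cross_min_max:
  assumes "i \<noteq> j" "k \<noteq> l"
  shows "cross {i, j} {k, l} \<longleftrightarrow>
    min i j < min k l \<and> min k l < max i j \<and> max i j < max k l \<or>
    min k l < min i j \<and> min i j < max k l \<and> max k l < max i j"
proof -
  have sorted: "{min i j, max i j} = {i, j}" "{min k l, max k l} = {k, l}"
    by (auto simp: min_def max_def)
  have "min i j < max i j" "min k l < max k l"
    using assms by auto
  from cross_doubleton[OF this] show ?thesis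
    unfolding sorted .
qed

lemma cross_sym: "cross e f \<longleftrightarrow> cross f e"
proof -
  have "cross f e" if "cross e f" for e f
  proof -
    from that obtain i j a b where "e = {i, j}" "f = {a, b}" "i < j" "a < b"
      by (auto simp: cross_def)
    with that show ?thesis
      by (auto simp: cross_doubleton)
  qed
  then show ?thesis by blast
qed

lemma cross_disjoint: "cross e f \<Longrightarrow> e \<inter> f = {}"
  unfolding cross_def by auto

lemma cross_irrefl [simp]: "\<not> cross e e"
  unfolding cross_def by auto

lemma three_crossing_freeD:
  "\<lbrakk>three_crossing_free T; e \<in> T; f \<in> T; g \<in> T; cross e f; cross e g; cross f g\<rbrakk> \<Longrightarrow> False"
  unfolding three_crossing_free_def by blast

text \<open>
  Maximality in the form in which it is used below: an edge that completes no 3-crossing is present.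
\<close>

lemma two_triangulation_memI:
  assumes T: "two_triangulation n T" and e: "e \<in> edges n"
    and free: "\<And>f g. \<lbrakk>f \<in> T; g \<in> T; cross e f; cross e g; cross f g\<rbrakk> \<Longrightarrow> False"
  shows "e \<in> T"
proof -
  have "three_crossing_free (insert e T)"
    unfolding three_crossing_free_def
  proof (intro notI, elim bexE conjE)
    fix x y z
    assume mem: "x \<in> insert e T" "y \<in> insert e T" "z \<in> insert e T"
      and c: "cross x y" "cross x z" "cross y z"
    then have "x \<noteq> y" "x \<noteq> z" "y \<noteq> z"
      by auto
    with mem consider "x \<in> T" "y \<in> T" "z \<in> T" | "x = e" "y \<in> T" "z \<in> T"
      | "y = e" "x \<in> T" "z \<in> T" | "z = e" "x \<in> T" "y \<in> T"
      by blast
    then show False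
    proof cases
      case 1
      with c T show False
        unfolding two_triangulation_def using three_crossing_freeD by blast
    qed (use c free cross_sym in metis)+
  qed
  then have "insert e T = T"
    using T e unfolding two_triangulation_def by blast
  then show ?thesis by auto
qed

text \<open>
  Edges through a common vertex do not cross each other, so an edge whose crossing edges all
  pass through one vertex cannot be part of a 3-crossing.
\<close>

lemma two_triangulation_hub:
  assumes "two_triangulation n T" "e \<in> edges n"
    and hub: "\<And>f. \<lbrakk>f \<in> edges n; cross e f\<rbrakk> \<Longrightarrow> v \<in> f"
  shows "e \<in> T"
proof (rule two_triangulation_memI[OF assms(1,2)])
  fix f g assume "f \<in> T" "g \<in> T" "cross e f" "cross e g" "cross f g"
  then show False
    using hub assms(1) cross_disjoint[of f g] unfolding two_triangulation_def by blast
qed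

text \<open>
  On one side of such an edge there is at most one vertex, and every crossing edge passes through it.
\<close>

lemma two_triangulation_short:
  assumes "two_triangulation n T" "1 \<le> i" "i < j" "j \<le> n"
    and "j \<le> i + 2 \<or> n \<le> j - i + 2"
  shows "{i, j} \<in> T"
proof (rule two_triangulation_hub[OF assms(1)])
  show "{i, j} \<in> edges n"
    using assms by (simp add: doubleton_in_edges)
  define v where "v = (if j \<le> i + 2 then i + 1 else if j = n then 1 else n)"
  fix f assume "f \<in> edges n" "cross {i, j} f"
  then show "v \<in> f"
    by (elim edges_obtain) (use assms in \<open>auto simp: v_def cross_doubleton\<close>)
qed

text \<open>
  Three pairwise crossing edges have six different endpoints.
\<close>

lemma two_triangulation_complete:
  assumes "two_triangulation n T" "n \<le> 5"
  shows "T = edges n"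
proof
  show "T \<subseteq> edges n"
    using assms unfolding two_triangulation_def by simp
  show "edges n \<subseteq> T"
  proof
    fix e assume "e \<in> edges n"
    then show "e \<in> T"
    proof (rule two_triangulation_memI[OF assms(1)])
      fix f g assume *: "f \<in> T" "g \<in> T" "cross e f" "cross e g" "cross f g"
      then have "e \<in> edges n" "f \<in> edges n" "g \<in> edges n"
        using \<open>e \<in> edges n\<close> assms(1) unfolding two_triangulation_def by auto
      with * assms(2) show False
        by (elim edges_obtain) (auto simp: cross_doubleton)
    qed
  qed
qed

text \<open>
  Let \<open>{i, i + L}\<close> be an edge of minimal length \<open>L \<ge> 3\<close>, where length means the difference of the
  endpoints; \<open>{1, n}\<close> shows that such edges exist. If \<open>{i, i + 3}\<close> completed a 3-crossing, the
  two other edges would start at \<open>i + 1\<close> and \<open>i + 2\<close> and, by minimality and because they cross each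
  other, end outside the interval from \<open>i\<close> to \<open>i + L\<close>. They would then form a 3-crossing with \<open>{i, i + L}\<close> as well.
\<close>

lemma ear_exists:
  assumes T: "two_triangulation n T" and n: "n \<ge> 4"
  obtains i where "1 \<le> i" "i + 3 \<le> n" "{i, i + 3} \<in> T"
proof -
  have TE: "T \<subseteq> edges n" and free: "three_crossing_free T"
    using T unfolding two_triangulation_def by auto
  define L where "L = (LEAST l. l \<ge> 3 \<and> (\<exists>i. {i, i + l} \<in> T))"
  have "{1, 1 + (n - 1)} \<in> T"
    using two_triangulation_short[OF T, of 1 n] n by simp
  then have "\<exists>l. l \<ge> 3 \<and> (\<exists>i. {i, i + l} \<in> T)"
    using n by (intro exI[of _ "n - 1"] conjI exI[of _ 1]) auto
  then have "L \<ge> 3 \<and> (\<exists>i. {i, i + L} \<in> T)"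
    unfolding L_def by (rule LeastI_ex)
  then obtain i where L: "L \<ge> 3" "{i, i + L} \<in> T" by blast
  have least: "y - x \<le> 2 \<or> L \<le> y - x" if "{x, y} \<in> T" "x < y" for x y
  proof (cases "y - x \<le> 2")
    case False
    then have "y - x \<ge> 3 \<and> (\<exists>i. {i, i + (y - x)} \<in> T)"
      using that by (intro conjI exI[of _ x]) auto
    then show ?thesis
      unfolding L_def by (intro disjI2 Least_le)
  qed simp
  have i: "1 \<le> i" "i + L \<le> n"
    using L TE by (auto simp: doubleton_in_edges)
  have "{i, i + 3} \<in> T"
  proof (rule two_triangulation_memI[OF T])
    show "{i, i + 3} \<in> edges n"
      using i L by (simp add: doubleton_in_edges)
    fix f g assume *: "f \<in> T" "g \<in> T" "cross {i, i + 3} f" "cross {i, i + 3} g" "cross f g"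
    have "f \<in> edges n" "g \<in> edges n"
      using * TE by auto
    then obtain x y z w where f: "f = {x, y}" "x < y" and g: "g = {z, w}" "z < w"
      by (elim edges_obtain)
    have xy: "x < i \<and> i < y \<and> y < i + 3 \<or> i < x \<and> x < i + 3 \<and> i + 3 < y"
      and zw: "z < i \<and> i < w \<and> w < i + 3 \<or> i < z \<and> z < i + 3 \<and> i + 3 < w"
      and fg: "x < z \<and> z < y \<and> y < w \<or> z < x \<and> x < w \<and> w < y"
      using * f g cross_doubleton[of i "i + 3" x y] cross_doubleton[of i "i + 3" z w]
        cross_doubleton[of x y z w] by auto
    have lf: "y \<le> x + 2 \<or> x + L \<le> y" and lg: "w \<le> z + 2 \<or> z + L \<le> w"
      using least[of x y] least[of z w] * f g by auto
    have "i < x \<and> x < i + L \<and> i + L < y \<or> x < i \<and> i < y \<and> y < i + L"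
      "i < z \<and> z < i + L \<and> i + L < w \<or> z < i \<and> i < w \<and> w < i + L"
      using xy zw fg lf lg L(1) by (elim disjE conjE; linarith)+
    then have "cross {i, i + L} f" "cross {i, i + L} g"
      using L(1) f g cross_doubleton[of i "i + L" x y] cross_doubleton[of i "i + L" z w] by auto
    with * free L show False
      using three_crossing_freeD by blast
  qed
  with i L show thesis
    by (intro that[of i]) auto
qed

section \<open>Contracting a pair of consecutive vertices\<close>

text \<open>
  The vertices \<open>a\<close> and \<open>Suc a\<close> are merged into \<open>a\<close> and the labels above are shifted down, so that the
  result is again a polygon with vertices \<open>1, \<dots>, m\<close>. The map \<open>skip a\<close> below is a section that avoids
  \<open>Suc a\<close>.
\<close>

definition contract :: "nat \<Rightarrow> nat \<Rightarrow> nat" where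
  "contract a v = (if v \<le> a then v else v - 1)"

definition skip :: "nat \<Rightarrow> nat \<Rightarrow> nat" where
  "skip a v = (if v \<le> a then v else Suc v)"

lemma contract_skip [simp]: "contract a (skip a v) = v"
  by (auto simp: contract_def skip_def)

lemma contract_simps [simp]: "contract a a = a" "contract a (Suc a) = a"
  by (auto simp: contract_def)

lemma skip_noteq_Suc [simp]: "skip a v \<noteq> Suc a"
  by (auto simp: skip_def)

lemma skip_eq_iff [simp]: "skip a v = a \<longleftrightarrow> v = a"
  by (auto simp: skip_def)

lemma skip_inject [simp]: "skip a u = skip a v \<longleftrightarrow> u = v"
  by (auto simp: skip_def)

lemma contract_eq_iff:
  "contract a u = contract a v \<longleftrightarrow> u = v \<or> {u, v} = {a, Suc a}"
  by (auto simp: contract_def doubleton_eq_iff)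

lemma contract_in_range: "\<lbrakk>v \<in> {1..Suc m}; 1 \<le> a; a \<le> m\<rbrakk> \<Longrightarrow> contract a v \<in> {1..m}"
  by (auto simp: contract_def)

lemma skip_in_range: "v \<in> {1..m} \<Longrightarrow> skip a v \<in> {1..Suc m}"
  by (auto simp: skip_def)

lemma contract_edge:
  assumes "e \<in> edges (Suc m)" "e \<noteq> {a, Suc a}" "1 \<le> a" "a \<le> m"
  shows "contract a ` e \<in> edges m"
proof -
  from assms(1) obtain i j where e: "e = {i, j}" "i < j" "1 \<le> i" "j \<le> Suc m"
    by (rule edges_obtain)
  then show ?thesis
    using assms contract_in_range[of i m a] contract_in_range[of j m a]
    by (auto simp: doubleton_in_edges contract_eq_iff)
qed

text \<open>
  Merging is monotone, so strict inequalities between images hold already between the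
  originals: no crossing is created.
\<close>

lemma cross_contractD:
  assumes "e \<in> edges n" "f \<in> edges n" "cross (contract a ` e) (contract a ` f)"
  shows "cross e f"
proof -
  from assms(1,2) obtain i j k l where
    e: "e = {i, j}" "i < j" and f: "f = {k, l}" "k < l"
    by (elim edges_obtain)
  have img: "contract a ` e = {contract a i, contract a j}"
    "contract a ` f = {contract a k, contract a l}"
    using e f by auto
  have le: "contract a i \<le> contract a j" "contract a k \<le> contract a l"
    using e f by (auto simp: contract_def)
  have "card (contract a ` e) = 2" "card (contract a ` f) = 2"
    using assms(3) by (auto simp: cross_def)
  then have "contract a i \<noteq> contract a j" "contract a k \<noteq> contract a l"
    unfolding img by (auto simp: card_insert_if split: if_splits)
  with le have lt: "contract a i < contract a j" "contract a k < contract a l"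
    by auto
  have mono: "u < v" if "contract a u < contract a v" for u v
    using that by (auto simp: contract_def split: if_splits)
  have "cross {contract a i, contract a j} {contract a k, contract a l}"
    using assms(3) unfolding img .
  then show ?thesis
    unfolding cross_doubleton[OF lt] e(1) f(1) cross_doubleton[OF e(2) f(2)]
    using mono by blast
qed

text \<open>
  A crossing is lost only when one edge uses \<open>a\<close> and the other one \<open>Suc a\<close>.
\<close>

lemma cross_contractI:
  assumes "e \<in> edges n" "f \<in> edges n" "cross e f"
    and "\<not> (a \<in> e \<and> Suc a \<in> f)" "\<not> (Suc a \<in> e \<and> a \<in> f)"
    and "e \<noteq> {a, Suc a}" "f \<noteq> {a, Suc a}"
  shows "cross (contract a ` e) (contract a ` f)"
proof -
  from assms(1,2) obtain i j k l where
    e: "e = {i, j}" "i < j" and f: "f = {k, l}" "k < l"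
    by (elim edges_obtain)
  have mono: "contract a u < contract a v" if "u < v" "u \<noteq> a \<or> v \<noteq> Suc a" for u v
    using that by (auto simp: contract_def)
  have lt: "contract a i < contract a j" "contract a k < contract a l"
    using e f assms mono by (auto simp: doubleton_eq_iff)
  have img: "contract a ` e = {contract a i, contract a j}"
    "contract a ` f = {contract a k, contract a l}"
    using e f by auto
  have mono': "contract a u < contract a v"
    if "u < v" "u \<in> e \<and> v \<in> f \<or> u \<in> f \<and> v \<in> e" for u v
    using that mono assms(4,5) by blast
  have "cross {i, j} {k, l}"
    using assms(3) e f by simp
  then show ?thesis
    unfolding img cross_doubleton[OF lt] cross_doubleton[OF e(2) f(2)]
    using mono' e(1) f(1) by blast
qed

text \<open>
  Merging identifies exactly the two sides of a triangle over \<open>{a, Suc a}\<close>.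
\<close>

lemma contract_fibre:
  assumes "e \<in> edges n" "f \<in> edges n" "contract a ` e = contract a ` f" "e \<noteq> f"
    and "e \<noteq> {a, Suc a}" "f \<noteq> {a, Suc a}"
  obtains z where "z \<noteq> a" "z \<noteq> Suc a" "{e, f} = {{a, z}, {Suc a, z}}"
proof -
  from assms(1,2) obtain i j k l where
    e: "e = {i, j}" "i < j" and f: "f = {k, l}" "k < l"
    by (elim edges_obtain)
  have ef: "{contract a i, contract a j} = {contract a k, contract a l}"
    using assms(3) e f by simp
  have "contract a i \<le> contract a j" "contract a k \<le> contract a l"
    using e f by (auto simp: contract_def)
  with ef have "contract a i = contract a k" "contract a j = contract a l"
    by (auto simp: doubleton_eq_iff)
  then consider "i = k" "{j, l} = {a, Suc a}" | "j = l" "{i, k} = {a, Suc a}"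
    | "{i, k} = {a, Suc a}" "{j, l} = {a, Suc a}"
    using assms(4) e f by (auto simp: contract_eq_iff)
  then show thesis
  proof cases
    case 1
    then show thesis
      using e f assms(4) that[of i] by (auto simp: doubleton_eq_iff)
  next
    case 2
    then show thesis
      using e f assms(4) that[of j] by (auto simp: doubleton_eq_iff)
  next
    case 3
    then show thesis
      using e f assms(4) by (auto simp: doubleton_eq_iff)
  qed
qed

section \<open>Contracting a 2-triangulation at an ear\<close>

text \<open>
  The situation of the inductive step: the vertices to be merged are \<open>a\<close> and \<open>Suc a\<close>, the two
  middle vertices below the edge \<open>{a - 1, a + 2}\<close>.
\<close>

locale eared_two_triangulation =
  fixes m a :: nat and T :: "nat set set"
  assumes T: "two_triangulation (Suc m) T"
    and m: "4 \<le> m" and a: "2 \<le> a" "a < m"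
    and ear: "{a - 1, a + 2} \<in> T"
begin

text \<open>
  The cyclic order of the polygon, cut open between \<open>a\<close> and \<open>Suc a\<close>: in it, \<open>Suc a\<close> is the first
  vertex and \<open>a\<close> the last. The edges \<open>{a, w}\<close> and \<open>{Suc a, z}\<close> then cross if and only if \<open>w\<close> comes
  before \<open>z\<close>.
\<close>

definition pos :: "nat \<Rightarrow> nat" where
  "pos z = (if a < z then z else z + Suc m)"

definition outer :: "nat set" where
  "outer = {1..Suc m} - {a - 1, a, Suc a, a + 2}"

lemma T_edges: "T \<subseteq> edges (Suc m)" and T_free: "three_crossing_free T"
  using T unfolding two_triangulation_def by auto

lemma cross_at_pair:
  assumes "w \<in> {1..Suc m} - {a, Suc a}" "z \<in> {1..Suc m} - {a, Suc a}"
  shows "cross {a, w} {Suc a, z} \<longleftrightarrow> pos w < pos z"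
  using assms by (subst cross_min_max) (auto simp: pos_def min_def max_def)

lemma crosses_ear:
  assumes "z \<in> outer"
  shows "cross {a - 1, a + 2} {a, z}" "cross {a - 1, a + 2} {Suc a, z}"
  using assms a by (auto simp: cross_min_max outer_def min_def max_def)

lemma hubs:
  assumes "f \<in> edges (Suc m)"
  shows "\<not> cross {a, Suc a} f"
    and "cross {a, a + 2} f \<Longrightarrow> Suc a \<in> f"
    and "cross {a - 1, Suc a} f \<Longrightarrow> a \<in> f"
  using a by - (rule edges_obtain[OF assms], auto simp: cross_doubleton)+

text \<open>
  The vertices \<open>a\<close> and \<open>Suc a\<close> are consecutive, so an edge that avoids both does not separate them.
\<close>

lemma cross_swap:
  assumes "e \<in> edges (Suc m)" "a \<notin> e" "Suc a \<notin> e" "z \<noteq> a" "z \<noteq> Suc a"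
    and "cross e {Suc a, z}"
  shows "cross e {a, z}"
proof -
  from assms(1) obtain i j where e: "e = {i, j}" "i < j"
    by (elim edges_obtain)
  show ?thesis
    using assms e(2) unfolding e(1) by (auto simp: cross_min_max min_def max_def split: if_splits)
qed

lemma pos_eq_iff: "w \<in> {1..Suc m} \<Longrightarrow> z \<in> {1..Suc m} \<Longrightarrow> pos w = pos z \<longleftrightarrow> w = z"
  by (auto simp: pos_def)

lemma close_edges: "{a, Suc a} \<in> T" "{a, a + 2} \<in> T" "{a - 1, Suc a} \<in> T" "{a - 1, a} \<in> T"
   "{Suc a, a + 2} \<in> T"
  using a by (auto intro!: two_triangulation_short[OF T])

text \<open>
  The apex \<open>c\<close> is the first outer neighbour of \<open>a\<close>. It is also a neighbour of \<open>Suc a\<close>: an edge that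
  crosses \<open>{Suc a, c}\<close> either crosses \<open>{a, c}\<close> too, or starts at \<open>a\<close> and ends before \<open>c\<close>. By the choice of
  \<open>c\<close>, the latter is only possible for \<open>{a, a + 2}\<close>, and all edges that cross \<open>{a, a + 2}\<close> use \<open>Suc a\<close>, so
  none of them crosses \<open>{Suc a, c}\<close>. Thus a 3-crossing with \<open>{Suc a, c}\<close> would give one with \<open>{a, c}\<close>.
  A neighbour of \<open>Suc a\<close> after \<open>c\<close> would produce a 3-crossing with \<open>{a, c}\<close> and the ear.
\<close>

lemma apex_exists:
  obtains c where "c \<in> outer" "{a, c} \<in> T" "{Suc a, c} \<in> T"
    "\<And>z. \<lbrakk>z \<in> outer; {a, z} \<in> T\<rbrakk> \<Longrightarrow> pos c \<le> pos z"
    "\<And>z. \<lbrakk>z \<in> outer; {Suc a, z} \<in> T\<rbrakk> \<Longrightarrow> pos z \<le> pos c"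
proof -
  define A where "A = {z \<in> outer. {a, z} \<in> T}"
  have "\<exists>z. z \<in> A"
  proof (cases "a = 2")
    case True
    have "{2, Suc m} \<in> T"
      using m by (intro two_triangulation_short[OF T]) auto
    moreover have "Suc m \<in> outer"
      unfolding outer_def using True m by auto
    ultimately show ?thesis
      using True unfolding A_def by blast
  next
    case False
    have "{a - 2, a} \<in> T"
      using a False by (intro two_triangulation_short[OF T]) auto
    then have "{a, a - 2} \<in> T"
      by (simp add: insert_commute)
    moreover have "a - 2 \<in> outer"
      unfolding outer_def using False a by auto
    ultimately show ?thesis
      unfolding A_def by blast
  qed
  then obtain c where c: "c \<in> A" and least: "\<And>z. z \<in> A \<Longrightarrow> pos c \<le> pos z"
    using ex_has_least_nat[of "\<lambda>z. z \<in> A" _ pos] by blast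
  have cO: "c \<in> outer" and ac: "{a, c} \<in> T" and cr: "c \<in> {1..Suc m} - {a, Suc a}"
    using c by (auto simp: A_def outer_def)
  \<comment> \<open>An edge of \<open>T\<close> from \<open>a\<close> that crosses \<open>{Suc a, c}\<close> must be \<open>{a, a + 2}\<close>, which leaves no room for the third edge \<open>f\<close>.\<close>
  have nocross: False
    if uf: "{a, u} \<in> T" "f \<in> T" "cross {Suc a, c} {a, u}" "cross {Suc a, c} f" "cross {a, u} f"
    for u f
  proof -
    have "{a, u} \<in> edges (Suc m)" "Suc a \<notin> {a, u}"
      using uf T_edges cross_disjoint[OF uf(3)] by auto
    then have u: "u \<in> {1..Suc m} - {a, Suc a}"
      by (auto simp: doubleton_in_edges)
    then have lt: "pos u < pos c"
      using cross_at_pair[OF u cr] uf(3) cross_sym by blast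
    then have "u \<notin> outer"
      using least[of u] uf(1) by (auto simp: A_def)
    then have "u = a - 1 \<or> u = a + 2"
      using u by (auto simp: outer_def)
    moreover have "u \<noteq> a - 1"
      using lt cO a by (auto simp: pos_def outer_def split: if_splits)
    ultimately have "u = a + 2" by blast
    then have "Suc a \<in> f"
      using hubs(2)[of f] uf T_edges by auto
    then show False
      using cross_disjoint[OF uf(4)] by auto
  qed
  have bc: "{Suc a, c} \<in> T"
  proof (rule two_triangulation_memI[OF T])
    show "{Suc a, c} \<in> edges (Suc m)"
      using cr a by (auto simp: doubleton_in_edges)
    fix f g assume *: "f \<in> T" "g \<in> T" "cross {Suc a, c} f" "cross {Suc a, c} g" "cross f g"
    have fE: "f \<in> edges (Suc m)" and gE: "g \<in> edges (Suc m)"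
      using * T_edges by auto
    have pair: "\<exists>u. e = {a, u}" if "e \<in> edges (Suc m)" "a \<in> e" for e
      using edge_at[OF that] by blast
    consider "a \<in> f" | "a \<in> g" | "a \<notin> f" "a \<notin> g" by blast
    then show False
    proof cases
      case 1
      then show False using pair[OF fE] nocross * by blast
    next
      case 2
      then show False using pair[OF gE] nocross * cross_sym by blast
    next
      case 3
      have "Suc a \<notin> f" "Suc a \<notin> g"
        using *(3,4) cross_disjoint by blast+
      then have "cross f {a, c}" "cross g {a, c}"
        using 3 cr *(3,4) fE gE cross_swap cross_sym by auto
      then show False
        using three_crossing_freeD[OF T_free] ac * cross_sym by blast
    qed
  qed
  have "pos z \<le> pos c" if z: "z \<in> outer" "{Suc a, z} \<in> T" for z
  proof (rule ccontr)
    assume "\<not> pos z \<le> pos c"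
    then have "cross {a, c} {Suc a, z}"
      using cross_at_pair[OF cr, of z] z by (auto simp: outer_def)
    then show False
      using three_crossing_freeD[OF T_free ear ac z(2)] crosses_ear cO z(1) by blast
  qed
  then show thesis
    using that[OF cO ac bc] least by (auto simp: A_def)
qed

definition contracted :: "nat set set" where
  "contracted = (\<lambda>e. contract a ` e) ` (T - {{a, Suc a}})"

definition common :: "nat set" where
  "common = {z. {a, z} \<in> T \<and> {Suc a, z} \<in> T}"

lemma card_common: "card common = 3"
proof -
  obtain c where c: "c \<in> outer" "{a, c} \<in> T" "{Suc a, c} \<in> T"
    "\<And>z. \<lbrakk>z \<in> outer; {a, z} \<in> T\<rbrakk> \<Longrightarrow> pos c \<le> pos z"
    "\<And>z. \<lbrakk>z \<in> outer; {Suc a, z} \<in> T\<rbrakk> \<Longrightarrow> pos z \<le> pos c"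
    using apex_exists by blast
  have "common = {a - 1, a + 2, c}"
  proof
    show "{a - 1, a + 2, c} \<subseteq> common"
      using c close_edges by (auto simp: common_def insert_commute)
    show "common \<subseteq> {a - 1, a + 2, c}"
    proof
      fix z assume z: "z \<in> common"
      then have "{a, z} \<in> edges (Suc m)" "{Suc a, z} \<in> edges (Suc m)"
        using T_edges by (auto simp: common_def)
      then have "z = a - 1 \<or> z = a + 2 \<or> z \<in> outer"
        by (auto simp: outer_def doubleton_in_edges)
      moreover have "z = c" if "z \<in> outer"
        using c(4,5)[of z] that z c(1) pos_eq_iff[of z c]
        by (auto simp: common_def outer_def)
      ultimately show "z \<in> {a - 1, a + 2, c}" by auto
    qed
  qed
  then show ?thesis
    using c(1) a by (auto simp: outer_def card_insert_if)
qed

lemma contracted_edges: "contracted \<subseteq> edges m"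
proof
  fix e' assume "e' \<in> contracted"
  then obtain e where "e \<in> T" "e \<noteq> {a, Suc a}" "e' = contract a ` e"
    by (auto simp: contracted_def)
  then show "e' \<in> edges m"
    using contract_edge[of e m a] T_edges a by auto
qed

lemma contracted_free: "three_crossing_free contracted"
  unfolding three_crossing_free_def
proof (intro notI, elim bexE conjE)
  fix e' f' g' assume *: "e' \<in> contracted" "f' \<in> contracted" "g' \<in> contracted"
    "cross e' f'" "cross e' g'" "cross f' g'"
  then obtain e f g where "e \<in> T" "f \<in> T" "g \<in> T"
    "e' = contract a ` e" "f' = contract a ` f" "g' = contract a ` g"
    by (auto simp: contracted_def)
  with * show False
    using three_crossing_freeD[OF T_free, of e f g] cross_contractD[of _ "Suc m" _ a] T_edges
    by blast
qed

text \<open>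
  The proof inflates \<open>S\<close> at the apex \<open>c\<close> to a set \<open>I\<close> of edges of the larger polygon: an edge of \<open>S\<close> from
  \<open>a\<close> to a vertex after \<open>c\<close> stays at \<open>a\<close>, one to a vertex before \<open>c\<close> moves to \<open>Suc a\<close>, the edges to \<open>c\<close>,
  \<open>a - 1\<close> and \<open>a + 2\<close> are doubled, and \<open>{a, Suc a}\<close> is added. An edge
  of \<open>I\<close> at \<open>a\<close> and one at \<open>Suc a\<close> do not cross, unless one of them lies in no 3-crossing at all. Hence a
  3-crossing in \<open>I\<close> would survive merging and give one in \<open>S\<close>.
  As \<open>I\<close> contains \<open>T\<close>, it equals \<open>T\<close>, and merging again gives \<open>S\<close>.
\<close>

lemma contracted_maximal:
  assumes S: "S \<subseteq> edges m" "three_crossing_free S" "contracted \<subseteq> S"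
  shows "S = contracted"
proof -
  obtain c where c: "c \<in> outer" "{a, c} \<in> T" "{Suc a, c} \<in> T"
    and minA: "\<And>z. \<lbrakk>z \<in> outer; {a, z} \<in> T\<rbrakk> \<Longrightarrow> pos c \<le> pos z"
    and maxB: "\<And>z. \<lbrakk>z \<in> outer; {Suc a, z} \<in> T\<rbrakk> \<Longrightarrow> pos z \<le> pos c"
    using apex_exists by blast
  \<comment> \<open>The exceptions \<open>{a, a + 2}\<close> and \<open>{Suc a, a - 1}\<close> can be admitted, being too short to occur in a 3-crossing.\<close>
  define ok where "ok e \<longleftrightarrow>
    (\<forall>z. e = {a, z} \<longrightarrow> z = a + 2 \<or> pos c \<le> pos z) \<and>
    (\<forall>z. e = {Suc a, z} \<longrightarrow> z = a - 1 \<or> pos z \<le> pos c)" for e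
  define I where "I = insert {a, Suc a} {e \<in> edges (Suc m). contract a ` e \<in> S \<and> ok e}"
  have IE: "I \<subseteq> edges (Suc m)"
    using a by (auto simp: I_def doubleton_in_edges)
  have pos_ends: "pos (a + 2) \<le> pos c" "pos c \<le> pos (a - 1)"
    using c(1) a by (auto simp: pos_def outer_def)
  have "T \<subseteq> I"
  proof
    fix e assume e: "e \<in> T"
    show "e \<in> I"
    proof (cases "e = {a, Suc a}")
      case False
      have eE: "e \<in> edges (Suc m)" using e T_edges by auto
      have "z = a + 2 \<or> pos c \<le> pos z" if "e = {a, z}" for z
        using minA[of z] e eE that False pos_ends
        by (cases "z \<in> outer") (auto simp: outer_def doubleton_in_edges)
      moreover have "z = a - 1 \<or> pos z \<le> pos c" if "e = {Suc a, z}" for z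
        using maxB[of z] e eE that False pos_ends
        by (cases "z \<in> outer") (auto simp: outer_def doubleton_in_edges insert_commute)
      ultimately have "ok e" unfolding ok_def by blast
      moreover have "contract a ` e \<in> S"
        using e False S(3) by (auto simp: contracted_def)
      ultimately show ?thesis
        using eE by (simp add: I_def)
    qed (simp add: I_def)
  qed
  moreover have "three_crossing_free I"
    unfolding three_crossing_free_def
  proof (intro notI, elim bexE conjE)
    fix e f g assume *: "e \<in> I" "f \<in> I" "g \<in> I" and X: "cross e f" "cross e g" "cross f g"
    have E: "e \<in> edges (Suc m)" "f \<in> edges (Suc m)" "g \<in> edges (Suc m)"
      using * IE by auto
    have X': "cross f e" "cross g e" "cross g f"
      using X cross_sym by auto
    \<comment> \<open>None of the three edges \<open>e, f, g\<close> is short, because the edges crossing a short edge share a vertex.\<close>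
    define short where "short = {{a, Suc a}, {a, a + 2}, {a - 1, Suc a}}"
    have no: "e \<notin> short" if "e \<in> edges (Suc m)" "f \<in> edges (Suc m)" "g \<in> edges (Suc m)"
      "cross e f" "cross e g" "cross f g" for e f g
      using that hubs[of f] hubs[of g] cross_disjoint[of f g] unfolding short_def by auto
    have sh: "e \<notin> short" "f \<notin> short" "g \<notin> short"
      using no[of e f g] no[of f e g] no[of g e f] E X X' by auto
    have apart: "\<not> (a \<in> x \<and> Suc a \<in> y)"
      if "x \<in> I" "y \<in> I" "x \<notin> short" "y \<notin> short" "cross x y" for x y
    proof
      assume mem: "a \<in> x \<and> Suc a \<in> y"
      have "x \<in> edges (Suc m)" "y \<in> edges (Suc m)"
        using that IE by auto
      with mem obtain w z where xy: "x = {a, w}" "y = {Suc a, z}"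
        and wz: "w \<noteq> a" "z \<noteq> Suc a" "w \<in> {1..Suc m}" "z \<in> {1..Suc m}"
        using edge_at by metis
      have "w \<noteq> Suc a" "z \<noteq> a"
        using xy that(3,4) by (auto simp: short_def insert_commute)
      then have "pos w < pos z"
        using cross_at_pair[of w z] wz that(5) xy by auto
      moreover have "ok {a, w}" "ok {Suc a, z}"
        using that(1-4) unfolding xy I_def short_def by blast+
      then have "w = a + 2 \<or> pos c \<le> pos w" "z = a - 1 \<or> pos z \<le> pos c"
        unfolding ok_def by blast+
      moreover have "w \<noteq> a + 2" "z \<noteq> a - 1"
        using that(3,4) unfolding xy short_def by (blast intro: insert_commute)+
      ultimately show False by linarith
    qed
    have sh': "e \<noteq> {a, Suc a}" "f \<noteq> {a, Suc a}" "g \<noteq> {a, Suc a}"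
      using sh by (auto simp: short_def)
    have "cross (contract a ` e) (contract a ` f)"
      by (rule cross_contractI[OF E(1,2) X(1)]; use apart[of e f] apart[of f e] * sh sh' X X' in blast)
    moreover have "cross (contract a ` e) (contract a ` g)"
      by (rule cross_contractI[OF E(1,3) X(2)]; use apart[of e g] apart[of g e] * sh sh' X X' in blast)
    moreover have "cross (contract a ` f) (contract a ` g)"
      by (rule cross_contractI[OF E(2,3) X(3)]; use apart[of f g] apart[of g f] * sh sh' X X' in blast)
    ultimately show False
      using three_crossing_freeD[OF S(2)] * sh' by (auto simp: I_def)
  qed
  ultimately have IT: "I = T"
    using T IE unfolding two_triangulation_def by blast
  have "S \<subseteq> contracted"
  proof
    fix e' assume e': "e' \<in> S"
    then have "e' \<in> edges m" using S by auto
    have "\<exists>e \<in> edges (Suc m). contract a ` e = e' \<and> ok e"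
    proof (cases "a \<in> e'")
      case False
      from \<open>e' \<in> edges m\<close> obtain x y where xy: "e' = {x, y}" "x < y" "1 \<le> x" "y \<le> m"
        by (elim edges_obtain)
      have "{skip a x, skip a y} \<in> edges (Suc m)"
        using xy skip_in_range[of x m a] skip_in_range[of y m a] by (auto simp: doubleton_in_edges)
      moreover have "ok {skip a x, skip a y}"
        using False xy by (auto simp: ok_def doubleton_eq_iff)
      ultimately show ?thesis
        using xy by (intro bexI[of _ "{skip a x, skip a y}"]) auto
    next
      case True
      with \<open>e' \<in> edges m\<close> obtain y where y: "e' = {a, y}" "y \<noteq> a" "y \<in> {1..m}"
        using edge_at by metis
      define z where "z = skip a y"
      have z: "z \<noteq> a" "z \<noteq> Suc a" "z \<in> {1..Suc m}" "contract a z = y"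
        using y skip_in_range[of y m a] by (auto simp: z_def)
      show ?thesis
      proof (cases "pos c \<le> pos z")
        case True
        then have "ok {a, z}"
          using z by (auto simp: ok_def doubleton_eq_iff)
        then show ?thesis
          using z y a by (intro bexI[of _ "{a, z}"]) (auto simp: doubleton_in_edges)
      next
        case False
        then have "ok {Suc a, z}"
          using z by (auto simp: ok_def doubleton_eq_iff)
        then show ?thesis
          using z y a by (intro bexI[of _ "{Suc a, z}"]) (auto simp: doubleton_in_edges)
      qed
    qed
    then obtain e where e: "e \<in> edges (Suc m)" "contract a ` e = e'" "ok e" by blast
    then have "e \<in> T"
      using e' IT by (auto simp: I_def)
    moreover have "e \<noteq> {a, Suc a}"
      using \<open>e' \<in> edges m\<close> e(2) by (auto simp: edges_def)
    ultimately show "e' \<in> contracted"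
      using e(2) by (auto simp: contracted_def)
  qed
  with S(3) show ?thesis by blast
qed

lemma contracted_two_triangulation: "two_triangulation m contracted"
  using contracted_edges contracted_free contracted_maximal
  unfolding two_triangulation_def by blast

text \<open>
  Discarding \<open>{a, Suc a}\<close> and, for each of the three common neighbours, the edge at \<open>Suc a\<close> leaves exactly
  one edge over each merged edge.
\<close>

lemma card_contracted: "card T = card contracted + 4"
proof -
  let ?doubled = "(\<lambda>z. {Suc a, z}) ` common"
  define T1 where "T1 = T - {{a, Suc a}} - ?doubled"
  have fin: "finite T"
    by (rule finite_subset[OF T_edges]) simp
  have finC: "finite common"
    using card_common card.infinite by fastforce
  have common_neq: "z \<noteq> a" "z \<noteq> Suc a" if "z \<in> common" for z
  proof -
    have "{a, z} \<in> edges (Suc m)" "{Suc a, z} \<in> edges (Suc m)"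
      using that T_edges by (auto simp: common_def)
    then show "z \<noteq> a" "z \<noteq> Suc a"
      unfolding doubleton_in_edges by auto
  qed
  have T1: "e \<in> T" "e \<in> edges (Suc m)" "e \<noteq> {a, Suc a}" "e \<notin> ?doubled" if "e \<in> T1" for e
    using that T_edges by (auto simp: T1_def)
  have "bij_betw (\<lambda>e. contract a ` e) T1 contracted"
    unfolding bij_betw_def
  proof
    show "inj_on (\<lambda>e. contract a ` e) T1"
    proof (rule inj_onI, rule ccontr)
      fix e f assume e: "e \<in> T1" and f: "f \<in> T1" and "contract a ` e = contract a ` f" "e \<noteq> f"
      then obtain z where "{e, f} = {{a, z}, {Suc a, z}}"
        using contract_fibre[OF T1(2)[OF e] T1(2)[OF f] _ _ T1(3)[OF e] T1(3)[OF f]] by metis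
      then have "e = {a, z} \<and> f = {Suc a, z} \<or> e = {Suc a, z} \<and> f = {a, z}"
        unfolding doubleton_eq_iff[of e f] .
      then have "z \<in> common" "e \<in> ?doubled \<or> f \<in> ?doubled"
        using T1(1)[OF e] T1(1)[OF f] by (auto simp: common_def)
      then show False
        using T1(4)[OF e] T1(4)[OF f] by blast
    qed
    have "contract a ` e \<in> (\<lambda>e. contract a ` e) ` T1" if e: "e \<in> T" "e \<noteq> {a, Suc a}" for e
    proof (cases "e \<in> ?doubled")
      case True
      then obtain z where z: "z \<in> common" "e = {Suc a, z}" by blast
      then have "{a, z} \<in> T" by (simp add: common_def)
      moreover have "{a, z} \<noteq> {a, Suc a}" "{a, z} \<notin> ?doubled"
        using common_neq[OF z(1)] common_neq by (auto simp: doubleton_eq_iff)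
      ultimately have "{a, z} \<in> T1" by (simp add: T1_def)
      moreover have "contract a ` e = contract a ` {a, z}" using z by simp
      ultimately show ?thesis by blast
    next
      case False
      with e show ?thesis by (auto simp: T1_def)
    qed
    then show "(\<lambda>e. contract a ` e) ` T1 = contracted"
      unfolding contracted_def by (auto simp: T1_def)
  qed
  then have "card T1 = card contracted"
    by (rule bij_betw_same_card)
  moreover have "card T = card T1 + 4"
  proof -
    have "inj_on (\<lambda>z. {Suc a, z}) common"
      by (auto simp: inj_on_def doubleton_eq_iff)
    then have "card ?doubled = 3"
      using card_common by (simp add: card_image)
    moreover have "{a, Suc a} \<notin> ?doubled"
      using common_neq by (auto simp: doubleton_eq_iff)
    moreover have sub: "insert {a, Suc a} ?doubled \<subseteq> T"
      using close_edges by (auto simp: common_def)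
    ultimately have "card (insert {a, Suc a} ?doubled) = 4"
      using finC by simp
    moreover have "T1 = T - insert {a, Suc a} ?doubled"
      by (auto simp: T1_def)
    ultimately show ?thesis
      using card_Diff_subset[OF _ sub] card_mono[OF fin sub] finC by simp
  qed
  ultimately show ?thesis by simp
qed

end

section \<open>Polynomial functions and families depending polynomially on parameters\<close>

definition monomial_value :: "(nat \<Rightarrow> real) \<Rightarrow> (nat \<Rightarrow>\<^sub>0 nat) \<Rightarrow> real" where
  "monomial_value t m = (\<Prod>i\<in>Poly_Mapping.keys m. t i ^ Poly_Mapping.lookup m i)"

lemma monomial_value_superset:
  assumes "finite K" "Poly_Mapping.keys m \<subseteq> K"
  shows "monomial_value t m = (\<Prod>i\<in>K. t i ^ Poly_Mapping.lookup m i)"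
  unfolding monomial_value_def
  using assms by (intro prod.mono_neutral_left) (auto simp: in_keys_iff)

lemma monomial_value_add: "monomial_value t (m + m') = monomial_value t m * monomial_value t m'"
proof -
  let ?K = "Poly_Mapping.keys m \<union> Poly_Mapping.keys m'"
  have "Poly_Mapping.keys (m + m') \<subseteq> ?K"
    by (rule Poly_Mapping.keys_add)
  then show ?thesis
    by (simp add: monomial_value_superset[of ?K] lookup_add power_add prod.distrib)
qed

lemma eval_mpoly_superset:
  assumes "finite K" "Poly_Mapping.keys P \<subseteq> K"
  shows "eval_mpoly t P = (\<Sum>m\<in>K. Poly_Mapping.lookup P m * monomial_value t m)"
  unfolding eval_mpoly_def monomial_value_def[symmetric]
  using assms by (intro sum.mono_neutral_left) (auto simp: in_keys_iff)

lemma eval_mpoly_zero [simp]: "eval_mpoly t 0 = 0"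
  by (simp add: eval_mpoly_def)

lemma eval_mpoly_add: "eval_mpoly t (P + Q) = eval_mpoly t P + eval_mpoly t Q"
proof -
  let ?K = "Poly_Mapping.keys P \<union> Poly_Mapping.keys Q"
  have "Poly_Mapping.keys (P + Q) \<subseteq> ?K"
    by (rule Poly_Mapping.keys_add)
  then show ?thesis
    by (simp add: eval_mpoly_superset[of ?K] lookup_add algebra_simps sum.distrib)
qed

lemma eval_mpoly_sum: "eval_mpoly t (\<Sum>x\<in>A. f x) = (\<Sum>x\<in>A. eval_mpoly t (f x))"
  by (induction A rule: infinite_finite_induct) (auto simp: eval_mpoly_add)

lemma eval_mpoly_single: "eval_mpoly t (Poly_Mapping.single m c) = c * monomial_value t m"
  by (simp add: eval_mpoly_def monomial_value_def)

lemma eval_mpoly_one: "eval_mpoly t 1 = 1"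
  by (simp add: eval_mpoly_def)

lemma mpoly_sum_of_monomials:
  fixes P :: real_mpoly
  shows "P = (\<Sum>m\<in>Poly_Mapping.keys P. Poly_Mapping.single m (Poly_Mapping.lookup P m))"
proof (rule poly_mapping_eqI)
  fix k
  have "(\<Sum>m\<in>Poly_Mapping.keys P. Poly_Mapping.lookup P m when m = k) = Poly_Mapping.lookup P k"
    by (simp add: when_def sum.delta in_keys_iff)
  then show "Poly_Mapping.lookup P k = Poly_Mapping.lookup
    (\<Sum>m\<in>Poly_Mapping.keys P. Poly_Mapping.single m (Poly_Mapping.lookup P m)) k"
    by (simp add: lookup_sum lookup_single)
qed

lemma eval_mpoly_mult: "eval_mpoly t (P * Q) = eval_mpoly t P * eval_mpoly t Q"
proof -
  let ?s = "\<lambda>P m. Poly_Mapping.single m (Poly_Mapping.lookup P m)"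
  have "P * Q = (\<Sum>m\<in>Poly_Mapping.keys P. ?s P m) * (\<Sum>m\<in>Poly_Mapping.keys Q. ?s Q m)"
    using mpoly_sum_of_monomials[of P] mpoly_sum_of_monomials[of Q] by simp
  also have "\<dots> = (\<Sum>m\<in>Poly_Mapping.keys P. \<Sum>m'\<in>Poly_Mapping.keys Q.
      Poly_Mapping.single (m + m') (Poly_Mapping.lookup P m * Poly_Mapping.lookup Q m'))"
    by (simp add: sum_product mult_single)
  finally have "eval_mpoly t (P * Q) = (\<Sum>m\<in>Poly_Mapping.keys P. \<Sum>m'\<in>Poly_Mapping.keys Q.
      (Poly_Mapping.lookup P m * monomial_value t m) *
      (Poly_Mapping.lookup Q m' * monomial_value t m'))"
    by (simp add: eval_mpoly_sum eval_mpoly_single monomial_value_add mult_ac)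
  then show ?thesis
    by (simp add: eval_mpoly_superset[of "Poly_Mapping.keys P" P]
        eval_mpoly_superset[of "Poly_Mapping.keys Q" Q] sum_product)
qed

lemma vars_in_add: "\<lbrakk>vars_in V P; vars_in V Q\<rbrakk> \<Longrightarrow> vars_in V (P + Q)"
  unfolding vars_in_def using Poly_Mapping.keys_add[of P Q] by blast

lemma vars_in_mult:
  assumes "vars_in V P" "vars_in V Q"
  shows "vars_in V (P * Q)"
  unfolding vars_in_def
proof
  fix m assume "m \<in> Poly_Mapping.keys (P * Q)"
  then obtain a b where "m = a + b" "a \<in> Poly_Mapping.keys P" "b \<in> Poly_Mapping.keys Q"
    using keys_mult[of P Q] by blast
  then show "Poly_Mapping.keys m \<subseteq> V"
    using assms Poly_Mapping.keys_add[of a b] unfolding vars_in_def by blast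
qed

lemma vars_in_one: "vars_in V 1"
  by (simp add: vars_in_def)

lemma vars_in_prod: "(\<And>x. x \<in> A \<Longrightarrow> vars_in V (f x)) \<Longrightarrow> vars_in V (\<Prod>x\<in>A. f x)"
  by (induction A rule: infinite_finite_induct) (auto intro: vars_in_mult vars_in_one)

lemma eval_mpoly_prod: "eval_mpoly t (\<Prod>x\<in>A. f x) = (\<Prod>x\<in>A. eval_mpoly t (f x))"
  by (induction A rule: infinite_finite_induct) (simp_all add: eval_mpoly_mult eval_mpoly_one)

text \<open>
  A predicate on functions, so that closure properties can be used without handling the
  coefficients of the polynomial.
\<close>

definition poly_fun :: "nat set \<Rightarrow> ((nat \<Rightarrow> real) \<Rightarrow> real) \<Rightarrow> bool" where
  "poly_fun V f \<longleftrightarrow> (\<exists>P. vars_in V P \<and> (\<forall>t. eval_mpoly t P = f t))"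

lemma poly_fun_const: "poly_fun V (\<lambda>t. c)"
  unfolding poly_fun_def
  by (intro exI[of _ "Poly_Mapping.single 0 c"])
    (auto simp: eval_mpoly_single monomial_value_def vars_in_def)

lemma poly_fun_var: "i \<in> V \<Longrightarrow> poly_fun V (\<lambda>t. t i)"
  unfolding poly_fun_def
  by (intro exI[of _ "Poly_Mapping.single (Poly_Mapping.single i 1) 1"])
    (auto simp: eval_mpoly_single monomial_value_def vars_in_def)

lemma poly_fun_add: "\<lbrakk>poly_fun V f; poly_fun V g\<rbrakk> \<Longrightarrow> poly_fun V (\<lambda>t. f t + g t)"
  unfolding poly_fun_def using vars_in_add eval_mpoly_add by metis

lemma poly_fun_mult: "\<lbrakk>poly_fun V f; poly_fun V g\<rbrakk> \<Longrightarrow> poly_fun V (\<lambda>t. f t * g t)"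
  unfolding poly_fun_def using vars_in_mult eval_mpoly_mult by metis

lemma poly_fun_diff: "\<lbrakk>poly_fun V f; poly_fun V g\<rbrakk> \<Longrightarrow> poly_fun V (\<lambda>t. f t - g t)"
  using poly_fun_add[of V f "\<lambda>t. (- 1) * g t"] poly_fun_mult[OF poly_fun_const, of V g "- 1"]
  by simp

lemma poly_fun_power: "poly_fun V f \<Longrightarrow> poly_fun V (\<lambda>t. f t ^ k)"
  by (induction k) (auto intro: poly_fun_const poly_fun_mult)

lemmas poly_fun_intros =
  poly_fun_const poly_fun_var poly_fun_add poly_fun_diff poly_fun_mult poly_fun_power

lemma poly_fun_continuous_along_line:
  assumes "poly_fun V f"
  shows "continuous_on UNIV (\<lambda>x. f (t(i := x)))"
proof -
  obtain P where P: "\<And>t. eval_mpoly t P = f t"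
    using assms unfolding poly_fun_def by blast
  have "continuous_on UNIV (\<lambda>x. (t(i := x)) k)" for k
    by (cases "k = i") auto
  then have "continuous_on UNIV (\<lambda>x. eval_mpoly (t(i := x)) P)"
    unfolding eval_mpoly_def by (intro continuous_intros)
  then show ?thesis
    by (simp add: P)
qed

text \<open>
  Linear independence of the vectors \<open>r e\<close> as an indexed family. The sums are taken column by
  column, so that row operations need no vector space structure.
\<close>

definition independent_family :: "'e set \<Rightarrow> ('e \<Rightarrow> 'x \<Rightarrow> real) \<Rightarrow> bool" where
  "independent_family E r \<longleftrightarrow>
     (\<forall>w. (\<forall>x. (\<Sum>e\<in>E. w e * r e x) = 0) \<longrightarrow> (\<forall>e\<in>E. w e = 0))"

lemma independent_familyD:
  assumes "independent_family E r" "\<And>x. (\<Sum>e\<in>E. w e * r e x) = 0" "e \<in> E"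
  shows "w e = 0"
  using assms unfolding independent_family_def by blast

text \<open>
  Gaussian elimination without division. Choose a column \<open>x\<close> in which the first row does not vanish
  at \<open>t0\<close>, clear this column in the other rows by cross-multiplication, and apply induction to
  the remaining rows. The polynomial obtained is the product of the pivots.
\<close>

lemma independent_family_open:
  fixes R :: "'e \<Rightarrow> 'x \<Rightarrow> (nat \<Rightarrow> real) \<Rightarrow> real"
  assumes "finite E"
    and "\<And>e x. e \<in> E \<Longrightarrow> poly_fun V (R e x)"
    and "independent_family E (\<lambda>e x. R e x t0)"
  shows "\<exists>f. poly_fun V f \<and> f t0 \<noteq> 0 \<and>
    (\<forall>t. f t \<noteq> 0 \<longrightarrow> independent_family E (\<lambda>e x. R e x t))"
  using assms
proof (induction E arbitrary: R rule: finite_induct)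
  case empty
  show ?case
    by (intro exI[of _ "\<lambda>t. 1"]) (auto simp: independent_family_def poly_fun_const)
next
  case (insert e E)
  have poly: "\<And>x. poly_fun V (R e x)" "\<And>f x. f \<in> E \<Longrightarrow> poly_fun V (R f x)"
    using insert.prems by auto
  have "\<exists>x. R e x t0 \<noteq> 0"
  proof (rule ccontr)
    assume "\<nexists>x. R e x t0 \<noteq> 0"
    then have "(\<Sum>f\<in>insert e E. of_bool (f = e) * R f x t0) = 0" for x
      by (auto intro!: sum.neutral)
    from independent_familyD[OF insert.prems(2) this, of e] show False
      by simp
  qed
  then obtain x where x: "R e x t0 \<noteq> 0" ..
  define R' where "R' f y = (\<lambda>t. R e x t * R f y t - R f x t * R e y t)" for f y
  have R'_sum: "(\<Sum>f\<in>E. w f * R' f y t) =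
    R e x t * (\<Sum>f\<in>E. w f * R f y t) - (\<Sum>f\<in>E. w f * R f x t) * R e y t" for w y t
    by (simp add: R'_def sum_distrib_left sum_distrib_right sum_subtractf algebra_simps)
  have "independent_family E (\<lambda>f y. R' f y t0)"
    unfolding independent_family_def
  proof (intro allI impI)
    fix w assume w: "\<forall>y. (\<Sum>f\<in>E. w f * R' f y t0) = 0"
    \<comment> \<open>Undoes the elimination: the coefficient of the pivot row is chosen so that column \<open>x\<close> vanishes.\<close>
    define w' where "w' f = (if f = e then - (\<Sum>f\<in>E. w f * R f x t0) else w f * R e x t0)" for f
    have "(\<Sum>f\<in>insert e E. w' f * R f y t0) = 0" for y
    proof -
      have "(\<Sum>f\<in>E. w' f * R f y t0) = (\<Sum>f\<in>E. w f * R e x t0 * R f y t0)"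
        using insert.hyps by (intro sum.cong) (auto simp: w'_def)
      also have "\<dots> = R e x t0 * (\<Sum>f\<in>E. w f * R f y t0)"
        by (simp add: sum_distrib_left mult_ac)
      also have "\<dots> = (\<Sum>f\<in>E. w f * R f x t0) * R e y t0"
        using w R'_sum[of w y t0] by simp
      finally show ?thesis
        using insert.hyps by (simp add: w'_def)
    qed
    from independent_familyD[OF insert.prems(2) this] have "\<forall>f\<in>insert e E. w' f = 0"
      by blast
    then show "\<forall>f\<in>E. w f = 0"
      using insert.hyps x by (auto simp: w'_def split: if_splits)
  qed
  moreover have "\<And>f y. f \<in> E \<Longrightarrow> poly_fun V (R' f y)"
    unfolding R'_def using poly by (intro poly_fun_intros)
  ultimately obtain g where g: "poly_fun V g" "g t0 \<noteq> 0"
    "\<And>t. g t \<noteq> 0 \<Longrightarrow> independent_family E (\<lambda>f y. R' f y t)"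
    using insert.IH[of R'] by blast
  have "independent_family (insert e E) (\<lambda>f y. R f y t)" if t: "g t * R e x t \<noteq> 0" for t
    unfolding independent_family_def
  proof (intro allI impI)
    fix w assume w: "\<forall>y. (\<Sum>f\<in>insert e E. w f * R f y t) = 0"
    have sum: "(\<Sum>f\<in>E. w f * R f y t) = - w e * R e y t" for y
      using w[rule_format, of y] insert.hyps by simp
    have "(\<Sum>f\<in>E. w f * R' f y t) = 0" for y
      by (simp add: R'_sum sum)
    moreover have ind: "independent_family E (\<lambda>f y. R' f y t)"
      using g(3) t by simp
    ultimately have E0: "\<forall>f\<in>E. w f = 0"
      using independent_familyD[OF ind, of w] by blast
    then have "w e * R e x t = 0"
      using sum[of x] by simp
    then show "\<forall>f\<in>insert e E. w f = 0"
      using E0 t by auto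
  qed
  moreover have "poly_fun V (\<lambda>t. g t * R e x t)"
    using g(1) poly by (intro poly_fun_intros)
  ultimately show ?case
    using g(2) x by (intro exI[of _ "\<lambda>t. g t * R e x t"]) auto
qed

section \<open>Polynomial identities behind the moment curve\<close>

lemma pderiv_sum: "pderiv (\<Sum>x\<in>A. f x) = (\<Sum>x\<in>A. pderiv (f x))"
  using higher_pderiv_sum[of 1 f A] by simp

lemma poly_pderiv_conv_sum:
  fixes p :: "real poly"
  assumes "degree p \<le> d"
  shows "poly (pderiv p) x = (\<Sum>k\<le>d. coeff p k * (of_nat k * x ^ (k - 1)))"
proof -
  have "poly (pderiv p) x = poly (pderiv (\<Sum>k\<le>d. monom (coeff p k) k)) x"
    by (simp add: poly_as_sum_of_monoms'[OF assms])
  also have "\<dots> = (\<Sum>k\<le>d. coeff p k * (of_nat k * x ^ (k - 1)))"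
    by (simp add: pderiv_sum pderiv_monom poly_sum poly_monom mult_ac)
  finally show ?thesis .
qed

lemma poly_conv_sum:
  fixes p :: "real poly"
  assumes "degree p \<le> d"
  shows "poly p x = (\<Sum>k\<le>d. coeff p k * x ^ k)"
proof -
  have "poly p x = poly (\<Sum>k\<le>d. monom (coeff p k) k) x"
    by (simp add: poly_as_sum_of_monoms'[OF assms])
  then show ?thesis
    by (simp add: poly_sum poly_monom)
qed

lemma degree_prod_linear_le:
  "degree (\<Prod>j\<in>J. [:- t j, 1 :: real:]) \<le> card J"
  using degree_prod_sum_le[of J "\<lambda>j. [:- t j, 1:]"]
  by (cases "finite J") auto

text \<open>
  The hypothesis says that a linear functional vanishes on the monomials \<open>x, x\<^sup>2, x\<^sup>3, x\<^sup>4\<close>; it kills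
  constants, too, and therefore all polynomials of degree at most 4. Evaluated at
  \<open>(x - s)\<^sup>2\<close> times the linear factors of all chord endpoints but the \<open>j\<close>-th, it gives a
  nonzero multiple of \<open>b j\<close>; once all \<open>b j\<close> vanish, so does \<open>c\<close>.
\<close>

lemma tangent_chords_independent:
  fixes t :: "'i \<Rightarrow> real"
  assumes J: "finite J" "card J \<le> 3" "inj_on t J" "s \<notin> t ` J"
    and eq: "\<And>k. k \<in> {1..4} \<Longrightarrow>
      c * (of_nat k * s ^ (k - 1)) + (\<Sum>j\<in>J. b j * (s ^ k - t j ^ k)) = 0"
  shows "c = 0 \<and> (\<forall>j\<in>J. b j = 0)"
proof -
  have poly_eq: "c * poly (pderiv p) s + (\<Sum>j\<in>J. b j * (poly p s - poly p (t j))) = 0"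
    if p: "degree p \<le> 4" for p
  proof -
    have "c * (of_nat k * s ^ (k - 1)) + (\<Sum>j\<in>J. b j * (s ^ k - t j ^ k)) = 0" if "k \<le> 4" for k
      using eq[of k] that by (cases "k = 0") auto
    then have "(\<Sum>k\<le>4. coeff p k *
        (c * (of_nat k * s ^ (k - 1)) + (\<Sum>j\<in>J. b j * (s ^ k - t j ^ k)))) = 0"
      by simp
    also have "(\<Sum>k\<le>4. coeff p k *
        (c * (of_nat k * s ^ (k - 1)) + (\<Sum>j\<in>J. b j * (s ^ k - t j ^ k)))) =
      c * poly (pderiv p) s + (\<Sum>k\<le>4. \<Sum>j\<in>J. b j * (coeff p k * s ^ k - coeff p k * t j ^ k))"
      unfolding poly_pderiv_conv_sum[OF p]
      by (simp add: distrib_left sum.distrib sum_distrib_left algebra_simps)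
    also have "(\<Sum>k\<le>4. \<Sum>j\<in>J. b j * (coeff p k * s ^ k - coeff p k * t j ^ k)) =
      (\<Sum>j\<in>J. b j * (poly p s - poly p (t j)))"
      by (subst sum.swap) (simp add: poly_conv_sum[OF p] sum_distrib_left sum_subtractf right_diff_distrib)
    finally show ?thesis .
  qed
  have b: "b j = 0" if j: "j \<in> J" for j
  proof -
    define q where "q = (\<Prod>i\<in>J - {j}. [:- t i, 1:])"
    \<comment> \<open>The double root at \<open>s\<close> removes the tangent term and the value at \<open>s\<close>, the factor \<open>q\<close> all chords but the \<open>j\<close>-th.\<close>
    define p where "p = [:- s, 1:] ^ 2 * q"
    have "degree q \<le> 2"
      using degree_prod_linear_le[of t "J - {j}"] J j unfolding q_def by (auto simp: card_Diff_singleton)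
    moreover have "degree ([:- s, 1:] ^ 2) = 2"
      by (simp add: degree_power_eq)
    ultimately have "degree p \<le> 4"
      using degree_mult_le[of "[:- s, 1:] ^ 2" q] unfolding p_def by linarith
    moreover have "poly p s = 0" "poly (pderiv p) s = 0"
      by (simp_all add: p_def pderiv_mult pderiv_pCons power2_eq_square del: mult_pCons_left)
    moreover have "poly p (t i) = 0" if "i \<in> J" "i \<noteq> j" for i
    proof -
      have "poly q (t i) = 0"
        unfolding q_def poly_prod using that J by (intro prod_zero) auto
      then show ?thesis by (simp add: p_def)
    qed
    then have "(\<Sum>i\<in>J. b i * poly p (t i)) = b j * poly p (t j)"
      using J j by (subst sum.remove[of _ j]) auto
    ultimately have "b j * poly p (t j) = 0"
      using poly_eq[of p] by (simp add: sum_negf)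
    moreover have "poly p (t j) \<noteq> 0"
      using J j by (auto simp: p_def q_def poly_prod inj_on_def)
    ultimately show ?thesis by simp
  qed
  then show ?thesis
    using eq[of 1] by simp
qed

lemma lagrange_interpolation:
  fixes p :: "real poly"
  assumes J: "finite J" "inj_on t J" "degree p < card J"
  shows "poly p x = (\<Sum>l\<in>J. poly p (t l) * (\<Prod>q\<in>J - {l}. (x - t q) / (t l - t q)))"
proof -
  define d where "d l = (\<Prod>q\<in>J - {l}. t l - t q)" for l
  define L where "L = (\<Sum>l\<in>J. smult (poly p (t l) / d l) (\<Prod>q\<in>J - {l}. [:- t q, 1:]))"
  have poly_L: "poly L y = (\<Sum>l\<in>J. poly p (t l) * (\<Prod>q\<in>J - {l}. (y - t q) / (t l - t q)))" for y
    by (simp add: L_def d_def poly_sum poly_prod prod_dividef)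
  have "p = L"
  proof (rule poly_eqI_degree[of "t ` J"])
    fix y assume "y \<in> t ` J"
    then obtain i where i: "i \<in> J" "y = t i" by blast
    have "(\<Prod>q\<in>J - {l}. (t i - t q) / (t l - t q)) = of_bool (l = i)" if "l \<in> J" for l
    proof (cases "l = i")
      case True
      have "(t i - t q) / (t l - t q) = 1" if "q \<in> J - {l}" for q
        using that True i inj_onD[OF J(2), of i q] by auto
      then show ?thesis
        using True by (simp add: prod.neutral)
    next
      case False
      then have "(\<Prod>q\<in>J - {l}. (t i - t q) / (t l - t q)) = 0"
        using J(1) i by (intro prod_zero) auto
      then show ?thesis
        using False by simp
    qed
    then have "poly L y = (\<Sum>l\<in>J. poly p (t l) * of_bool (l = i))"
      by (simp add: poly_L i(2))
    also have "\<dots> = poly p y"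
      using J i by (simp add: sum.delta)
    finally show "poly p y = poly L y" ..
  next
    have card: "card (t ` J) = card J"
      using J by (simp add: card_image)
    then show "card (t ` J) > degree p" using J by simp
    have "degree (smult (poly p (t l) / d l) (\<Prod>q\<in>J - {l}. [:- t q, 1:])) \<le> card J - 1"
      if "l \<in> J" for l
      using degree_prod_linear_le[of t "J - {l}"] degree_smult_le[of "poly p (t l) / d l"] that J
      by (metis card_Diff_singleton le_trans)
    then have "degree L \<le> card J - 1"
      unfolding L_def using J by (intro degree_sum_le) auto
    then show "card (t ` J) > degree L" using J card by linarith
  qed
  then show ?thesis
    using poly_L by metis
qed

section \<open>Rigidity rows on the moment curve\<close>

abbreviation moment_row :: "(nat \<Rightarrow> real) \<Rightarrow> nat set \<Rightarrow> nat \<times> 4 \<Rightarrow> real" where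
  "moment_row t \<equiv> rigidity_matrix (\<lambda>i. moment_curve (t i))"

text \<open>
  The first divided difference of the moment curve. It is a polynomial in both parameters, and
  for \<open>u = v\<close> it is the tangent vector.
\<close>

definition normalized_chord :: "real \<Rightarrow> real \<Rightarrow> real ^ 4" where
  "normalized_chord u v = vector [1, u + v, u ^ 2 + u * v + v ^ 2, u ^ 3 + u ^ 2 * v + u * v ^ 2 + v ^ 3]"

lemma normalized_chord_nth:
  "normalized_chord u v $ 1 = 1" "normalized_chord u v $ 2 = u + v"
  "normalized_chord u v $ 3 = u ^ 2 + u * v + v ^ 2"
  "normalized_chord u v $ 4 = u ^ 3 + u ^ 2 * v + u * v ^ 2 + v ^ 3"
  by (simp_all add: normalized_chord_def vector_def)

lemma normalized_chord_scaled:
  "(u - v) * normalized_chord u v $ k = (moment_curve u - moment_curve v) $ k"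
  using exhaust_4[of k]
  by (auto simp: normalized_chord_nth moment_curve_nth power2_eq_square power3_eq_cube
      power4_eq_xxxx algebra_simps)

lemma moment_chords_independent:
  assumes J: "finite J" "card J \<le> 3" "inj_on t J" "s \<notin> t ` J"
    and eq: "\<And>k. c * normalized_chord s s $ k +
      (\<Sum>j\<in>J. b j * (moment_curve s - moment_curve (t j)) $ k) = 0"
  shows "c = 0 \<and> (\<forall>j\<in>J. b j = 0)"
proof (rule tangent_chords_independent[OF J])
  fix k :: nat assume "k \<in> {1..4}"
  then consider "k = 1" | "k = 2" | "k = 3" | "k = 4" by force
  then show "c * (of_nat k * s ^ (k - 1)) + (\<Sum>j\<in>J. b j * (s ^ k - t j ^ k)) = 0"
    by cases (use eq[of 1] eq[of 2] eq[of 3] eq[of 4] in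
      \<open>simp_all add: normalized_chord_nth moment_curve_nth power2_eq_square power3_eq_cube algebra_simps\<close>)
qed

text \<open>
  In a column of the vertex \<open>v\<close> only the edges at \<open>v\<close> contribute, which turns a sum over edges into a
  sum over neighbours.
\<close>

lemma sum_over_star:
  fixes g :: "nat set \<Rightarrow> real"
  assumes "finite E" "v \<notin> Z" "\<And>z. z \<in> Z \<Longrightarrow> {v, z} \<in> E"
    and "\<And>e. \<lbrakk>e \<in> E; g e \<noteq> 0\<rbrakk> \<Longrightarrow> \<exists>z\<in>Z. e = {v, z}"
  shows "sum g E = (\<Sum>z\<in>Z. g {v, z})"
proof -
  have inj: "inj_on (\<lambda>z. {v, z}) Z"
    by (auto simp: inj_on_def doubleton_eq_iff)
  have "sum g E = sum g ((\<lambda>z. {v, z}) ` Z)"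
    using assms by (intro sum.mono_neutral_right) auto
  also have "\<dots> = (\<Sum>z\<in>Z. g {v, z})"
    by (simp add: sum.reindex[OF inj])
  finally show ?thesis .
qed

lemma rigidity_matrix_outside: "v \<notin> e \<Longrightarrow> rigidity_matrix p e (v, k) = 0"
  by (simp add: rigidity_matrix_def)

text \<open>
  At each vertex the dependence is a relation between the three chords of the moment curve to the
  other vertices.
\<close>

lemma complete_graph_independent:
  assumes t: "inj_on t {1..4}"
  shows "independent_family (edges 4) (moment_row t)"
  unfolding independent_family_def
proof (intro allI impI ballI)
  fix w :: "nat set \<Rightarrow> real" and e
  assume w: "\<forall>x. (\<Sum>e\<in>edges 4. w e * moment_row t e x) = 0" and e: "e \<in> edges 4"
  obtain v u where vu: "e = {v, u}" "v \<noteq> u" "v \<in> {1..4}" "u \<in> {1..4}"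
    using e by (rule edges_obtain) auto
  let ?Z = "{1..4} - {v}"
  have "(\<Sum>z\<in>?Z. w {v, z} * (moment_curve (t v) - moment_curve (t z)) $ k) = 0" for k
  proof -
    have "(\<Sum>e\<in>edges 4. w e * moment_row t e (v, k)) =
        (\<Sum>z\<in>?Z. w {v, z} * moment_row t {v, z} (v, k))"
    proof (rule sum_over_star)
      fix e assume "e \<in> edges 4" "w e * moment_row t e (v, k) \<noteq> 0"
      then have "e \<in> edges 4" "v \<in> e"
        using rigidity_matrix_outside by auto
      then show "\<exists>z\<in>?Z. e = {v, z}"
        by (elim edge_at) auto
    qed (use vu in \<open>auto simp: doubleton_in_edges\<close>)
    also have "\<dots> = (\<Sum>z\<in>?Z. w {v, z} * (moment_curve (t v) - moment_curve (t z)) $ k)"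
      by (intro sum.cong) (auto simp: rigidity_matrix_edge)
    finally show ?thesis
      using w by simp
  qed
  moreover have "inj_on t ?Z"
    using t by (rule inj_on_subset) auto
  moreover have "t v \<notin> t ` ?Z"
    using inj_onD[OF t] vu(3) by blast
  moreover have "card ?Z \<le> 3"
    using vu(3) by simp
  ultimately have "\<forall>z\<in>?Z. w {v, z} = 0"
    using moment_chords_independent[of ?Z t "t v" 0 "\<lambda>z. w {v, z}"] by simp
  then show "w e = 0"
    using vu by auto
qed

section \<open>Vertex splitting\<close>

text \<open>
  The rigidity rows, with the row of \<open>{a, Suc a}\<close> divided by \<open>t a - t (Suc a)\<close>. In this form the
  row remains nonzero when the two parameters coincide.
\<close>

definition split_row :: "nat \<Rightarrow> nat set \<Rightarrow> nat \<times> 4 \<Rightarrow> (nat \<Rightarrow> real) \<Rightarrow> real" where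
  "split_row a e x = (\<lambda>t. if e = {a, Suc a} then
     (if fst x = a then normalized_chord (t a) (t (Suc a)) $ snd x
      else if fst x = Suc a then - normalized_chord (t a) (t (Suc a)) $ snd x else 0)
     else moment_row t e x)"

lemma split_row_scaled:
  "moment_row t e x = (if e = {a, Suc a} then t a - t (Suc a) else 1) * split_row a e x t"
proof (cases "e = {a, Suc a}")
  case True
  obtain v k where x: "x = (v, k)" by fastforce
  have "moment_row t {a, Suc a} (v, k) =
    (if v = a then (moment_curve (t a) - moment_curve (t (Suc a))) $ k
     else if v = Suc a then - ((moment_curve (t a) - moment_curve (t (Suc a))) $ k) else 0)"
    by (auto simp: rigidity_matrix_edge)
  then show ?thesis
    using True normalized_chord_scaled[of "t a" "t (Suc a)" k] unfolding x by (auto simp: split_row_def)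
qed (simp add: split_row_def)

lemma poly_fun_moment_curve: "i \<in> V \<Longrightarrow> poly_fun V (\<lambda>t. moment_curve (t i) $ k)"
  using exhaust_4[of k] by (auto simp: moment_curve_nth intro!: poly_fun_intros)

lemma poly_fun_moment_row:
  assumes "e \<in> edges n"
  shows "poly_fun {1..n} (\<lambda>t. moment_row t e x)"
proof -
  obtain v k where x: "x = (v, k)" by fastforce
  show ?thesis
  proof (cases "v \<in> e")
    case True
    then obtain z where z: "e = {v, z}" "z \<noteq> v" "z \<in> {1..n}"
      using assms edge_at by blast
    then have "v \<in> {1..n}"
      using assms by (simp add: doubleton_in_edges)
    with z show ?thesis
      unfolding x by (auto simp: rigidity_matrix_edge intro!: poly_fun_intros poly_fun_moment_curve)
  qed (simp add: x rigidity_matrix_outside poly_fun_const)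
qed

lemma poly_fun_split_row:
  assumes "e \<in> edges n" "a \<in> {1..n}" "Suc a \<in> {1..n}"
  shows "poly_fun {1..n} (split_row a e x)"
proof -
  have chord: "poly_fun {1..n} (\<lambda>t. normalized_chord (t a) (t (Suc a)) $ k)" for k
    using exhaust_4[of k] assms by (auto simp: normalized_chord_nth intro!: poly_fun_intros)
  have neg: "poly_fun {1..n} (\<lambda>t. - normalized_chord (t a) (t (Suc a)) $ k)" for k
    using poly_fun_diff[OF poly_fun_const chord, of 0 k] by simp
  show ?thesis
    unfolding split_row_def
    using chord[of "snd x"] neg[of "snd x"] poly_fun_moment_row[OF assms(1), of x]
    by (cases "e = {a, Suc a}"; cases "fst x = a"; cases "fst x = Suc a")
      (simp_all add: poly_fun_const)
qed

text \<open>
  If the points of \<open>a\<close> and \<open>Suc a\<close> coincide, adding their columns yields the row of the merged edge.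
\<close>

lemma moment_row_contract:
  assumes "e \<in> edges n" "e \<noteq> {a, Suc a}" "finite F" "\<And>v. v \<in> F \<longleftrightarrow> contract a v = v'"
  shows "(\<Sum>v\<in>F. moment_row (t \<circ> contract a) e (v, k)) = moment_row t (contract a ` e) (v', k)"
proof -
  obtain i j where e: "e = {i, j}" "i < j"
    using assms(1) by (rule edges_obtain)
  have row: "rigidity_matrix p {x, y} (v, k) =
      of_bool (v = x) * (p x - p y) $ k + of_bool (v = y) * (p y - p x) $ k"
    if "x \<noteq> y" for p :: "nat \<Rightarrow> real ^ 4" and x y v
    using that by (auto simp: rigidity_matrix_edge)
  have ne: "contract a i \<noteq> contract a j"
    using assms(2) e by (auto simp: contract_eq_iff)
  have delta: "(\<Sum>v\<in>F. of_bool (v = x) * c) = of_bool (v' = contract a x) * c" for x and c :: real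
  proof -
    have "(\<Sum>v\<in>F. of_bool (v = x) * c) = (\<Sum>v\<in>F. if v = x then c else 0)"
      by (intro sum.cong) auto
    then show ?thesis
      using assms(3,4) by (auto simp: sum.delta)
  qed
  show ?thesis
    using e ne by (simp add: row sum.distrib delta)
qed

text \<open>
  Vertex splitting in dimension 4, with the two copies of the vertex still at the same point.
  Adding the columns of the two copies sends a dependence of \<open>T\<close> to one of the merged set, so the coefficients
  over each merged edge sum to zero. This leaves pairs of opposite
  coefficients on the edges to common neighbours, and the coefficient of \<open>{a, Suc a}\<close>. The columns
  of \<open>a\<close> alone then give a relation between the tangent vector and at most three chords.
\<close>

lemma vertex_split_independent:
  fixes t :: "nat \<Rightarrow> real"
  assumes T: "T \<subseteq> edges (Suc m)" and a: "1 \<le> a" "a \<le> m"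
    and t: "inj_on t {1..m}"
    and common: "card {z. {a, z} \<in> T \<and> {Suc a, z} \<in> T} \<le> 3"
    and ind: "independent_family ((\<lambda>e. contract a ` e) ` (T - {{a, Suc a}})) (moment_row t)"
  shows "independent_family T (\<lambda>e x. split_row a e x (t \<circ> contract a))"
  unfolding independent_family_def
proof (intro allI impI)
  fix w :: "nat set \<Rightarrow> real"
  let ?t = "t \<circ> contract a" and ?R = "\<lambda>e x. split_row a e x (t \<circ> contract a)"
  assume w: "\<forall>x. (\<Sum>e\<in>T. w e * ?R e x) = 0"
  define C where "C = {z. {a, z} \<in> T \<and> {Suc a, z} \<in> T}"
  define T0 where "T0 = T - {{a, Suc a}}"
  have fin: "finite T" "finite T0"
    using T finite_subset[OF T] by (auto simp: T0_def)
  have C_range: "z \<in> {1..Suc m}" "z \<noteq> a" "z \<noteq> Suc a" if "z \<in> C" for z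
  proof -
    have "{a, z} \<in> edges (Suc m)" "{Suc a, z} \<in> edges (Suc m)"
      using that T by (auto simp: C_def)
    then show "z \<in> {1..Suc m}" "z \<noteq> a" "z \<noteq> Suc a"
      unfolding doubleton_in_edges by auto
  qed
  have finC: "finite C"
    by (rule finite_subset[of _ "{1..Suc m}"]) (use C_range(1) in blast, simp)
  have T0_row: "?R e x = moment_row ?t e x" if "e \<in> T0" for e x
    using that by (simp add: split_row_def T0_def)
  have push: "(\<Sum>e\<in>T0. w e * moment_row t (contract a ` e) x) = 0" for x
  proof -
    obtain v' k where x: "x = (v', k)" by fastforce
    \<comment> \<open>The fibre of \<open>contract a\<close> over the vertex \<open>v'\<close>.\<close>
    define F where "F = (if v' = a then {a, Suc a} else {skip a v'})"
    have F: "finite F" "\<And>v. v \<in> F \<longleftrightarrow> contract a v = v'"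
      by (auto simp: F_def contract_def skip_def)
    have "(\<Sum>v\<in>F. ?R {a, Suc a} (v, k)) = 0"
      by (auto simp: F_def split_row_def skip_def)
    then have ab: "(\<Sum>v\<in>F. w {a, Suc a} * ?R {a, Suc a} (v, k)) = 0"
      by (simp add: sum_distrib_left[symmetric])
    have "(\<Sum>v\<in>F. \<Sum>e\<in>T. w e * ?R e (v, k)) = 0"
      using w by simp
    also have "(\<Sum>v\<in>F. \<Sum>e\<in>T. w e * ?R e (v, k)) = (\<Sum>e\<in>T. \<Sum>v\<in>F. w e * ?R e (v, k))"
      by (rule sum.swap)
    also have "\<dots> = (\<Sum>e\<in>T0. \<Sum>v\<in>F. w e * ?R e (v, k))"
      using fin ab by (intro sum.mono_neutral_right) (auto simp: T0_def)
    also have "\<dots> = (\<Sum>e\<in>T0. w e * moment_row t (contract a ` e) x)"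
    proof (intro sum.cong refl)
      fix e assume e: "e \<in> T0"
      then have "(\<Sum>v\<in>F. moment_row ?t e (v, k)) = moment_row t (contract a ` e) (v', k)"
        using T F by (intro moment_row_contract[of _ "Suc m"]) (auto simp: T0_def)
      then show "(\<Sum>v\<in>F. w e * ?R e (v, k)) = w e * moment_row t (contract a ` e) x"
        using T0_row[OF e] by (simp add: sum_distrib_left[symmetric] x)
    qed
    finally show ?thesis .
  qed
  have fibre0: "(\<Sum>f\<in>{f \<in> T0. contract a ` f = contract a ` e}. w f) = 0" if "e \<in> T0" for e
  proof -
    define w' where "w' e' = (\<Sum>f\<in>{f \<in> T0. contract a ` f = e'}. w f)" for e'
    have "(\<Sum>e'\<in>(\<lambda>e. contract a ` e) ` T0. w' e' * moment_row t e' x) = 0" for x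
    proof -
      have "(\<Sum>e\<in>T0. w e * moment_row t (contract a ` e) x) =
        (\<Sum>e'\<in>(\<lambda>e. contract a ` e) ` T0. \<Sum>f\<in>{f \<in> T0. contract a ` f = e'}.
           w f * moment_row t (contract a ` f) x)"
        using fin by (intro sum.image_gen)
      also have "\<dots> = (\<Sum>e'\<in>(\<lambda>e. contract a ` e) ` T0. w' e' * moment_row t e' x)"
        by (simp add: w'_def sum_distrib_right)
      finally show ?thesis
        using push[of x] by simp
    qed
    then have "w' (contract a ` e) = 0"
      using independent_familyD[OF ind[folded T0_def]] that by blast
    then show ?thesis by (simp add: w'_def)
  qed
  have T0E: "f \<in> edges (Suc m)" "f \<noteq> {a, Suc a}" if "f \<in> T0" for f
    using that T by (auto simp: T0_def)
  have private0: "\<exists>z\<in>C. e = {a, z} \<or> e = {Suc a, z}" if e: "e \<in> T0" "w e \<noteq> 0" for e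
  proof -
    have "{f \<in> T0. contract a ` f = contract a ` e} \<noteq> {e}"
      using fibre0[OF e(1)] e(2) by auto
    then obtain f where f: "f \<in> T0" "contract a ` e = contract a ` f" "e \<noteq> f"
      using e(1) by force
    obtain z where z: "{e, f} = {{a, z}, {Suc a, z}}"
      by (rule contract_fibre[OF T0E(1)[OF e(1)] T0E(1)[OF f(1)] f(2,3)
            T0E(2)[OF e(1)] T0E(2)[OF f(1)]])
    then have "e = {a, z} \<and> f = {Suc a, z} \<or> e = {Suc a, z} \<and> f = {a, z}"
      unfolding doubleton_eq_iff[of e f] .
    moreover from this have "z \<in> C"
      using e(1) f(1) by (auto simp: C_def T0_def)
    ultimately show ?thesis by blast
  qed
  have C_T0: "{a, z} \<in> T0" "{Suc a, z} \<in> T0" if "z \<in> C" for z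
    using that C_range[OF that] by (auto simp: C_def T0_def doubleton_eq_iff)
  have opposite: "w {a, z} + w {Suc a, z} = 0" if z: "z \<in> C" for z
  proof -
    have "{f \<in> T0. contract a ` f = contract a ` {a, z}} = {{a, z}, {Suc a, z}}"
    proof (intro equalityI subsetI)
      fix f assume "f \<in> {f \<in> T0. contract a ` f = contract a ` {a, z}}"
      then have f: "f \<in> T0" "contract a ` {a, z} = contract a ` f" by auto
      show "f \<in> {{a, z}, {Suc a, z}}"
      proof (cases "f = {a, z}")
        case False
        obtain z' where "{{a, z}, f} = {{a, z'}, {Suc a, z'}}"
          by (rule contract_fibre[OF T0E(1)[OF C_T0(1)[OF z]] T0E(1)[OF f(1)] f(2)
              not_sym[OF False] T0E(2)[OF C_T0(1)[OF z]] T0E(2)[OF f(1)]])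
        then have "{a, z} = {a, z'} \<and> f = {Suc a, z'} \<or> {a, z} = {Suc a, z'}"
          unfolding doubleton_eq_iff[of "{a, z}" f] by blast
        then show ?thesis
          using C_range[OF z] by (auto simp: doubleton_eq_iff)
      qed simp
    qed (use C_T0[OF z] in auto)
    moreover have "{a, z} \<noteq> {Suc a, z}"
      using C_range[OF z] by (auto simp: doubleton_eq_iff)
    ultimately show ?thesis
      using fibre0[OF C_T0(1)[OF z]] by simp
  qed
  define c where "c = (if {a, Suc a} \<in> T then w {a, Suc a} else 0)"
  have "c * normalized_chord (t a) (t a) $ k +
      (\<Sum>z\<in>C. w {a, z} * (moment_curve (t a) - moment_curve (?t z)) $ k) = 0" for k
  proof -
    have "(\<Sum>e\<in>T0. w e * ?R e (a, k)) = (\<Sum>z\<in>C. w {a, z} * ?R {a, z} (a, k))"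
    proof (rule sum_over_star[OF fin(2)])
      show "a \<notin> C" using C_range by blast
      fix e assume e: "e \<in> T0" "w e * ?R e (a, k) \<noteq> 0"
      then have "a \<in> e"
        using T0_row[of e] rigidity_matrix_outside[of a e] by auto
      moreover obtain z where "z \<in> C" "e = {a, z} \<or> e = {Suc a, z}"
        using private0[of e] e by auto
      ultimately show "\<exists>z\<in>C. e = {a, z}"
        using C_range by auto
    qed (use C_T0 in auto)
    also have "\<dots> = (\<Sum>z\<in>C. w {a, z} * (moment_curve (t a) - moment_curve (?t z)) $ k)"
    proof (intro sum.cong refl)
      fix z assume z: "z \<in> C"
      then have "a \<noteq> z" using C_range(2) by blast
      then show "w {a, z} * ?R {a, z} (a, k) =
          w {a, z} * (moment_curve (t a) - moment_curve (?t z)) $ k"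
        by (simp add: T0_row[OF C_T0(1)[OF z]] rigidity_matrix_edge)
    qed
    finally have star: "(\<Sum>e\<in>T0. w e * ?R e (a, k)) = \<dots>" .
    have "(\<Sum>e\<in>T. w e * ?R e (a, k)) = c * normalized_chord (t a) (t a) $ k +
        (\<Sum>e\<in>T0. w e * ?R e (a, k))"
    proof (cases "{a, Suc a} \<in> T")
      case True
      then show ?thesis
        using fin sum.remove[OF fin(1) True, of "\<lambda>e. w e * ?R e (a, k)"]
        by (simp add: T0_def c_def split_row_def)
    next
      case False
      then have "T0 = T" by (simp add: T0_def)
      with False show ?thesis by (simp add: c_def)
    qed
    with star w show ?thesis by simp
  qed
  moreover have "inj_on ?t C"
  proof (rule inj_onI)
    fix y z assume yz: "y \<in> C" "z \<in> C" "?t y = ?t z"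
    have "contract a y = contract a z"
      using yz by (intro inj_onD[OF t] contract_in_range[OF C_range(1) a]) auto
    then show "y = z"
      using C_range(2)[OF yz(1)] C_range(3)[OF yz(1)] by (auto simp: contract_eq_iff doubleton_eq_iff)
  qed
  moreover have "t a \<notin> ?t ` C"
  proof
    assume "t a \<in> ?t ` C"
    then obtain z where z: "z \<in> C" "t a = t (contract a z)" by auto
    have "a = contract a z"
      using z a by (intro inj_onD[OF t] contract_in_range[OF C_range(1) a]) auto
    then show False
      using C_range[OF z(1)] by (auto simp: contract_def split: if_splits)
  qed
  ultimately have zero: "c = 0" "\<forall>z\<in>C. w {a, z} = 0"
    using moment_chords_independent[OF finC common[folded C_def], of ?t "t a" c "\<lambda>z. w {a, z}"]
    by auto
  show "\<forall>e\<in>T. w e = 0"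
  proof
    fix e assume e: "e \<in> T"
    show "w e = 0"
    proof (cases "e = {a, Suc a}")
      case True
      then show ?thesis using zero(1) e by (simp add: c_def)
    next
      case False
      then have "e \<in> T0" using e by (simp add: T0_def)
      then show ?thesis
        using private0[of e] zero(2) opposite by fastforce
    qed
  qed
qed

section \<open>Independence and size of 2-triangulations\<close>

context eared_two_triangulation
begin

text \<open>
  The position in which \<open>a\<close> and \<open>Suc a\<close> coincide satisfies a polynomial inequality that implies
  independence. By continuity the inequality survives a small displacement of \<open>Suc a\<close>, and only
  finitely many displacements make two parameters equal.
\<close>

lemma independent_parameters_from_contraction:
  assumes t: "inj_on t {1..m}" and ind: "independent_family contracted (moment_row t)"
  shows "\<exists>t'. inj_on t' {1..Suc m} \<and> independent_family T (moment_row t')"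
proof -
  let ?t = "t \<circ> contract a"
  have a': "1 \<le> a" "a \<le> m" using a by auto
  have "independent_family T (\<lambda>e x. split_row a e x ?t)"
    using card_common by (intro vertex_split_independent[OF T_edges a' t _ ind[unfolded contracted_def]])
      (simp add: common_def)
  moreover have "poly_fun {1..Suc m} (split_row a e x)" if "e \<in> T" for e x
    using that T_edges a' by (intro poly_fun_split_row) auto
  ultimately obtain f where f: "poly_fun {1..Suc m} f" "f ?t \<noteq> 0"
    "\<And>s. f s \<noteq> 0 \<Longrightarrow> independent_family T (\<lambda>e x. split_row a e x s)"
    using independent_family_open[of T "{1..Suc m}" "split_row a" ?t]
      finite_subset[OF T_edges finite_edges] by blast
  have "open {x. f (?t(Suc a := x)) \<noteq> 0}"
    using poly_fun_continuous_along_line[OF f(1)] by (intro open_Collect_neq continuous_on_const)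
  moreover have "?t (Suc a) \<in> {x. f (?t(Suc a := x)) \<noteq> 0}"
    using f(2) by (simp only: mem_Collect_eq fun_upd_triv not_False_eq_True)
  ultimately have "infinite {x. f (?t(Suc a := x)) \<noteq> 0}"
    using finite_imp_not_open by blast
  then obtain x where x: "f (?t(Suc a := x)) \<noteq> 0" "x \<notin> ?t ` {1..Suc m}"
    using finite_subset[of "{x. f (?t(Suc a := x)) \<noteq> 0}" "?t ` {1..Suc m}"] by blast
  define s where "s = ?t(Suc a := x)"
  have "inj_on s {1..Suc m}"
  proof (rule inj_onI)
    fix u v assume uv: "u \<in> {1..Suc m}" "v \<in> {1..Suc m}" "s u = s v"
    have "?t u \<noteq> x" "?t v \<noteq> x"
      using x(2) uv by blast+
    then consider "u = v" | "u \<noteq> Suc a" "v \<noteq> Suc a" "?t u = ?t v"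
      using uv(3) by (auto simp: s_def split: if_splits)
    then show "u = v"
    proof cases
      case 2
      then have "contract a u = contract a v"
        using contract_in_range[OF uv(1) a'] contract_in_range[OF uv(2) a'] inj_onD[OF t] by simp
      then show ?thesis
        using 2 by (auto simp: contract_eq_iff doubleton_eq_iff)
    qed
  qed
  moreover have "independent_family T (moment_row s)"
    unfolding independent_family_def
  proof (intro allI impI)
    fix w assume w: "\<forall>x. (\<Sum>e\<in>T. w e * moment_row s e x) = 0"
    \<comment> \<open>The factors by which the rows of the normalized family have been divided.\<close>
    define d where "d e = (if e = {a, Suc a} then s a - s (Suc a) else 1)" for e :: "nat set"
    have "(\<Sum>e\<in>T. w e * d e * split_row a e x s) = 0" for x
      using w[rule_format, of x] unfolding split_row_scaled[of s _ x a] d_def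
      by (simp only: mult.assoc)
    then have "\<forall>e\<in>T. w e * d e = 0"
      using independent_familyD[OF f(3)[OF x(1)], of "\<lambda>e. w e * d e"] unfolding s_def by blast
    moreover have "s a \<noteq> s (Suc a)"
      using inj_onD[OF \<open>inj_on s {1..Suc m}\<close>, of a "Suc a"] a by auto
    then have "d e \<noteq> 0" for e by (simp add: d_def)
    ultimately show "\<forall>e\<in>T. w e = 0" by simp
  qed
  ultimately show ?thesis by blast
qed

end

text \<open>
  One position with pairwise distinct parameters is all that the induction has to provide, because
  independence at a single position already yields a nonzero polynomial. The induction starts with
  the complete graph on four vertices, which has \<open>6 = 4 * 4 - 10\<close> edges.
\<close>

lemma two_triangulation_independent:
  assumes "4 \<le> n" "two_triangulation n T"
  shows "card T + 10 = 4 * n \<and> (\<exists>t. inj_on t {1..n} \<and> independent_family T (moment_row t))"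
  using assms
proof (induction n arbitrary: T rule: dec_induct)
  case base
  have T: "T = edges 4"
    using base by (intro two_triangulation_complete) auto
  have "card (edges 4) = 6"
    by (simp add: edges_def n_subsets choose_two)
  moreover have inj: "inj_on real {1..4}"
    by (simp add: inj_on_def)
  ultimately show ?case
    using complete_graph_independent[OF inj] inj unfolding T by (intro conjI exI[of _ real]) simp_all
next
  case (step m)
  obtain i where i: "1 \<le> i" "i + 3 \<le> Suc m" "{i, i + 3} \<in> T"
    using ear_exists[OF step.prems] step.hyps by auto
  \<comment> \<open>The ear is \<open>{i, i + 3}\<close>, so the merged vertices are \<open>i + 1\<close> and \<open>i + 2\<close>.\<close>
  interpret eared_two_triangulation m "Suc i" T
    using step i by unfold_locales (auto simp: numeral_3_eq_3)
  show ?case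
    using step.IH[OF contracted_two_triangulation] card_contracted
      independent_parameters_from_contraction by auto
qed

section \<open>The row space\<close>

text \<open>
  Lagrange interpolation at five of the six parameters reproduces the value at the sixth one for all
  polynomials of degree at most 4; the interpolation weights, together with \<open>-1\<close>, are the coefficients.
\<close>

lemma affine_dependence_moment_curve:
  assumes J: "finite J" "card J = 5" "inj_on t (insert j J)" "j \<notin> J"
  obtains l where "\<And>v. v \<in> insert j J \<Longrightarrow> l v \<noteq> (0 :: real)"
    "(\<Sum>v\<in>insert j J. l v) = 0"
    "\<And>k. (\<Sum>v\<in>insert j J. l v * moment_curve (t v) $ k) = 0"
proof -
  define l where "l v = (if v = j then -1 else \<Prod>q\<in>J - {v}. (t j - t q) / (t v - t q))" for v
  have tJ: "inj_on t J"
    using J(3) by (rule inj_on_subset) auto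
  have sum: "(\<Sum>v\<in>insert j J. l v * poly p (t v)) = 0" if "degree p < 5" for p
  proof -
    have "(\<Sum>v\<in>J. l v * poly p (t v)) = poly p (t j)"
      using lagrange_interpolation[OF J(1) tJ, of p "t j"] that J
      by (auto simp: l_def mult.commute intro!: sum.cong)
    then show ?thesis
      using J by (simp add: l_def)
  qed
  show thesis
  proof (rule that)
    show "l v \<noteq> 0" if "v \<in> insert j J" for v
    proof -
      have ne: "t x \<noteq> t y" if "x \<in> insert j J" "y \<in> insert j J" "x \<noteq> y" for x y
        using inj_onD[OF J(3), of x y] that by blast
      have "(t j - t q) / (t v - t q) \<noteq> 0" if "v \<noteq> j" "q \<in> J - {v}" for q
        using ne[of j q] ne[of v q] that \<open>v \<in> insert j J\<close> J(4) by auto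
      then show ?thesis
        using J(1) by (auto simp: l_def)
    qed
    show "(\<Sum>v\<in>insert j J. l v) = 0"
      using sum[of 1] by simp
    show "(\<Sum>v\<in>insert j J. l v * moment_curve (t v) $ k) = 0" for k
      using exhaust_4[of k] sum[of "monom 1 1"] sum[of "monom 1 2"] sum[of "monom 1 3"] sum[of "monom 1 4"]
      by (auto simp: moment_curve_nth poly_monom degree_monom_eq)
  qed
qed

lemma sum_fun_apply: "(\<Sum>x\<in>A. f x) y = (\<Sum>x\<in>A. f x y)"
  for f :: "'a \<Rightarrow> 'b \<Rightarrow> real"
  by (induction A rule: infinite_finite_induct) auto

lemma scaleR_fun_apply: "(c *\<^sub>R f) x = c * f x" for f :: "'b \<Rightarrow> real"
  by (simp add: scaleR_fun_def)

text \<open>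
  An affine dependence with coefficients \<open>l v\<close> makes the products \<open>l u * l v\<close> a dependence of the rows of the complete graph: the
  equation at \<open>v\<close> is \<open>l v * (p v * (\<Sum>u. l u) - (\<Sum>u. l u * p u)) = 0\<close>.
\<close>

lemma complete_graph_stress:
  assumes K: "finite K"
    and l: "(\<Sum>v\<in>K. l v) = 0" "\<And>k. (\<Sum>v\<in>K. l v * p v $ k) = 0"
  shows "(\<Sum>e | e \<subseteq> K \<and> card e = 2. (\<Prod>v\<in>e. l v) *\<^sub>R rigidity_matrix p e) = 0"
proof (rule ext)
  fix x :: "nat \<times> 'a"
  obtain v k where x: "x = (v, k)" by fastforce
  let ?E = "{e. e \<subseteq> K \<and> card e = 2}"
  have fin: "finite ?E"
    using K by (intro finite_subset[of ?E "Pow K"]) auto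
  have pair: "\<exists>z\<in>K - {v}. e = {v, z}" if "e \<in> ?E" "v \<in> e" for e
    using that by (auto simp: card_2_iff)
  have "(\<Sum>e\<in>?E. (\<Prod>v\<in>e. l v) * rigidity_matrix p e (v, k)) = 0"
  proof (cases "v \<in> K")
    case True
    have "(\<Sum>e\<in>?E. (\<Prod>v\<in>e. l v) * rigidity_matrix p e (v, k)) =
      (\<Sum>z\<in>K - {v}. (\<Prod>v\<in>{v, z}. l v) * rigidity_matrix p {v, z} (v, k))"
    proof (rule sum_over_star[OF fin])
      fix e assume e: "e \<in> ?E" "(\<Prod>v\<in>e. l v) * rigidity_matrix p e (v, k) \<noteq> 0"
      then have "v \<in> e"
        using rigidity_matrix_outside[of v e p k] by auto
      with e(1) show "\<exists>z\<in>K - {v}. e = {v, z}" by (rule pair)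
    qed (use True in auto)
    also have "\<dots> = (\<Sum>z\<in>K - {v}. l v * (l z * p v $ k - l z * p z $ k))"
      by (intro sum.cong) (auto simp: rigidity_matrix_edge algebra_simps)
    also have "\<dots> = l v * ((\<Sum>z\<in>K - {v}. l z) * p v $ k - (\<Sum>z\<in>K - {v}. l z * p z $ k))"
      by (simp add: sum_distrib_left sum_distrib_right sum_subtractf right_diff_distrib)
    also have "\<dots> = 0"
    proof -
      have "(\<Sum>z\<in>K - {v}. l z) = - l v"
        using sum.remove[OF K True, of l] l(1) by linarith
      moreover have "(\<Sum>z\<in>K - {v}. l z * p z $ k) = - (l v * p v $ k)"
        using sum.remove[OF K True, of "\<lambda>z. l z * p z $ k"] l(2)[of k] by linarith
      ultimately show ?thesis by simp
    qed
    finally show ?thesis .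
  next
    case False
    show ?thesis
    proof (intro sum.neutral ballI)
      fix e assume "e \<in> ?E"
      with False have "v \<notin> e" by blast
      then show "(\<Prod>v\<in>e. l v) * rigidity_matrix p e (v, k) = 0"
        by (simp add: rigidity_matrix_outside)
    qed
  qed
  then show "(\<Sum>e\<in>?E. (\<Prod>v\<in>e. l v) *\<^sub>R rigidity_matrix p e) x = 0 x"
    by (simp add: x sum_fun_apply scaleR_fun_apply)
qed

text \<open>
  The graph obtained from the complete graph on four vertices by joining each further vertex to
  these four. Its \<open>4 n - 10\<close> rows will span the row space.
\<close>

definition core_edges :: "nat \<Rightarrow> nat set set" where
  "core_edges n = {e \<in> edges n. e \<inter> {1..4} \<noteq> {}}"

lemma card_core_edges:
  assumes "4 \<le> n"
  shows "card (core_edges n) + 10 = 4 * n"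
proof -
  have choose: "(N + 4) choose 2 = (N choose 2) + 4 * N + 6" for N :: nat
    by (induction N) (auto simp: choose_two numeral_eq_Suc)
  define N where "N = n - 4"
  have n: "n = N + 4" using assms by (simp add: N_def)
  let ?rest = "{e. e \<subseteq> {5..n} \<and> card e = 2}"
  have "{1..n} = {1..4} \<union> {5..n}" "{1..4} \<inter> {5..n} = {}"
    using assms by auto
  then have "e \<inter> {1..4} = {} \<longleftrightarrow> e \<subseteq> {5..n}" if "e \<subseteq> {1..n}" for e
    using that by blast
  then have "core_edges n = edges n - ?rest"
    unfolding core_edges_def edges_def by blast
  moreover have "?rest \<subseteq> edges n"
    by (auto simp: edges_def)
  ultimately have "card (core_edges n) = card (edges n) - card ?rest"
    by (simp add: card_Diff_subset finite_subset[OF _ finite_edges])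
  moreover have "card (edges n) = (N + 4) choose 2" "card ?rest = N choose 2"
    by (simp_all add: edges_def n_subsets n add.commute)
  ultimately show ?thesis
    using choose[of N] n by simp
qed

text \<open>
  An edge \<open>{i, j}\<close> with \<open>4 < i < j\<close> is the only edge of the complete graph on \<open>{1, 2, 3, 4, i, j}\<close> that
  avoids the first four vertices, and it has a nonzero coefficient in a dependence of the rows of this graph.
\<close>

lemma row_space_core:
  assumes t: "inj_on t {1..n}"
  shows "row_space n (\<lambda>i. moment_curve (t i)) = span (moment_row t ` core_edges n)"
proof -
  have "moment_row t e \<in> span (moment_row t ` core_edges n)" if e: "e \<in> edges n" for e
  proof (cases "e \<in> core_edges n")
    case True
    then show ?thesis by (intro span_base) auto
  next
    case False
    from e obtain i j where ij: "e = {i, j}" "i < j" "1 \<le> i" "j \<le> n"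
      by (rule edges_obtain)
    with False e have "4 < i" by (auto simp: core_edges_def)
    define J where "J = insert i {1..4}"
    let ?K = "insert j J"
    have J: "finite J" "card J = 5" "j \<notin> J" "?K \<subseteq> {1..n}"
      using ij \<open>4 < i\<close> by (auto simp: J_def)
    obtain l where l: "\<And>v. v \<in> ?K \<Longrightarrow> l v \<noteq> 0" "(\<Sum>v\<in>?K. l v) = 0"
      "\<And>k. (\<Sum>v\<in>?K. l v * moment_curve (t v) $ k) = 0"
      using affine_dependence_moment_curve[OF J(1,2) inj_on_subset[OF t J(4)] J(3)] by blast
    let ?E = "{e. e \<subseteq> ?K \<and> card e = 2}" and ?s = "\<lambda>e. \<Prod>v\<in>e. l v"
    have finE: "finite ?E"
      using J(1) by (intro finite_subset[of ?E "Pow ?K"]) auto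
    have eE: "e \<in> ?E"
      using ij by (auto simp: J_def)
    have "(\<Sum>f\<in>?E. ?s f *\<^sub>R moment_row t f) = 0"
      using J(1) l by (intro complete_graph_stress) auto
    then have "?s e *\<^sub>R moment_row t e = - (\<Sum>f\<in>?E - {e}. ?s f *\<^sub>R moment_row t f)"
      using sum.remove[OF finE eE, of "\<lambda>f. ?s f *\<^sub>R moment_row t f"]
      by (simp add: eq_neg_iff_add_eq_0)
    also have "\<dots> \<in> span (moment_row t ` core_edges n)"
    proof (intro span_neg span_sum span_scale span_base imageI)
      fix f assume f: "f \<in> ?E - {e}"
      have "f \<inter> {1..4} \<noteq> {}"
      proof
        assume "f \<inter> {1..4} = {}"
        moreover have "f \<subseteq> {i, j} \<union> {1..4}"
          using f by (auto simp: J_def)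
        ultimately have "f \<subseteq> e"
          unfolding ij(1) by blast
        moreover have "finite e" "card f = card e"
          using f eE ij(1) by auto
        ultimately have "f = e"
          using card_subset_eq by blast
        then show False using f by blast
      qed
      moreover have "f \<subseteq> {1..n}" "card f = 2"
        using f J(4) by blast+
      ultimately show "f \<in> core_edges n"
        by (simp add: core_edges_def edges_def)
    qed
    finally have "inverse (?s e) *\<^sub>R (?s e *\<^sub>R moment_row t e) \<in> span (moment_row t ` core_edges n)"
      by (rule span_scale)
    moreover have "?s e \<noteq> 0"
      using l(1) ij by (auto simp: J_def)
    ultimately show ?thesis by simp
  qed
  then have "row_space n (\<lambda>i. moment_curve (t i)) \<subseteq> span (moment_row t ` core_edges n)"
    unfolding row_space_def by (intro span_minimal) auto
  moreover have "span (moment_row t ` core_edges n) \<subseteq> row_space n (\<lambda>i. moment_curve (t i))"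
    unfolding row_space_def by (intro span_mono image_mono) (auto simp: core_edges_def)
  ultimately show ?thesis by blast
qed

lemma independent_family_imp_independent:
  fixes r :: "'e \<Rightarrow> 'x \<Rightarrow> real"
  assumes "finite E" "independent_family E r"
  shows "inj_on r E" "independent (r ` E)"
proof -
  show inj: "inj_on r E"
  proof (rule inj_onI, rule ccontr)
    fix e f assume ef: "e \<in> E" "f \<in> E" "r e = r f" "e \<noteq> f"
    let ?w = "\<lambda>g. (if g = e then 1 else 0) - (if g = f then 1 else 0) :: real"
    have "(\<Sum>g\<in>E. ?w g * r g x) = 0" for x
    proof -
      have "(\<Sum>g\<in>E. ?w g * r g x) =
        (\<Sum>g\<in>E. if g = e then r g x else 0) - (\<Sum>g\<in>E. if g = f then r g x else 0)"
        unfolding sum_subtractf[symmetric] by (intro sum.cong) auto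
      then show ?thesis
        using ef assms(1) by (simp add: sum.delta)
    qed
    from independent_familyD[OF assms(2) this ef(1)] ef(4) show False by simp
  qed
  have "u (r e) = 0" if u: "(\<Sum>v\<in>r ` E. u v *\<^sub>R v) = 0" and e: "e \<in> E" for u e
  proof -
    have "(\<Sum>e\<in>E. u (r e) *\<^sub>R r e) = 0"
      using u by (simp add: sum.reindex[OF inj])
    then have "(\<Sum>e\<in>E. u (r e) *\<^sub>R r e) x = 0" for x
      by simp
    then have "(\<Sum>e\<in>E. u (r e) * r e x) = 0" for x
      unfolding sum_fun_apply scaleR_fun_apply .
    from independent_familyD[OF assms(2) this e] show ?thesis .
  qed
  then show "independent (r ` E)"
    using assms(1) by (auto simp: dependent_finite)
qed

text \<open>
  The independent rows of \<open>T\<close> lie in a space that is spanned by equally many vectors.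
\<close>

lemma independent_imp_isostatic:
  assumes n: "4 \<le> n" and t: "inj_on t {1..n}" and T: "two_triangulation n T"
    and ind: "independent_family T (moment_row t)"
  shows "isostatic n (\<lambda>i. moment_curve (t i)) T"
proof -
  let ?r = "moment_row t"
  have TE: "T \<subseteq> edges n"
    using T by (simp add: two_triangulation_def)
  then have "finite T" by (rule finite_subset) simp
  note T_ind = independent_family_imp_independent[OF this ind]
  have core: "finite (core_edges n)"
    by (simp add: core_edges_def)
  have sub: "?r ` T \<subseteq> span (?r ` core_edges n)"
    unfolding row_space_core[OF t, symmetric] row_space_def
    using TE by (auto intro: span_base)
  have "?r f \<in> span (?r ` T)" if f: "f \<in> core_edges n" for f
  proof (rule ccontr)
    assume out: "?r f \<notin> span (?r ` T)"
    then have "independent (insert (?r f) (?r ` T))"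
      using T_ind(2) by (rule independent_insertI)
    moreover have "insert (?r f) (?r ` T) \<subseteq> span (?r ` core_edges n)"
      using sub f by (simp add: span_base)
    ultimately have "card (insert (?r f) (?r ` T)) \<le> card (?r ` core_edges n)"
      using independent_span_bound[OF finite_imageI[OF core]] by blast
    also have "\<dots> \<le> card (core_edges n)"
      by (rule card_image_le[OF core])
    also have "\<dots> = card T"
      using card_core_edges[OF n] two_triangulation_independent[OF n T] by simp
    also have "\<dots> = card (?r ` T)"
      by (simp add: card_image T_ind(1))
    finally have "?r f \<in> ?r ` T"
      using \<open>finite T\<close> by (simp add: card_insert_if split: if_splits)
    with out show False by (simp add: span_base)
  qed
  then have "span (?r ` core_edges n) \<subseteq> span (?r ` T)"
    by (intro span_minimal) auto
  moreover have "span (?r ` T) \<subseteq> span (?r ` core_edges n)"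
    using sub by (simp add: span_minimal)
  ultimately show ?thesis
    unfolding isostatic_def row_space_core[OF t] using TE T_ind by auto
qed

section \<open>Generic isostaticity\<close>

theorem theorem1p5:
  fixes n :: nat
  assumes "n \<ge> 5"
  shows "for_generic n (\<lambda>t. strict_mono_on {1..n} t \<longrightarrow>
           (\<forall>T. two_triangulation n T \<longrightarrow> isostatic n (\<lambda>i. moment_curve (t i)) T))"
proof -
  have n: "4 \<le> n" using assms by simp
  let ?\<T> = "{T. two_triangulation n T}"
  have fin: "finite ?\<T>"
    by (rule finite_subset[of _ "Pow (edges n)"]) (auto simp: two_triangulation_def)
  have "\<exists>P. P \<noteq> 0 \<and> vars_in {1..n} P \<and>
      (\<forall>t. eval_mpoly t P \<noteq> 0 \<longrightarrow> independent_family T (moment_row t))"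
    if T: "two_triangulation n T" for T
  proof -
    have TE: "T \<subseteq> edges n"
      using T by (simp add: two_triangulation_def)
    obtain t0 where t0: "independent_family T (moment_row t0)"
      using two_triangulation_independent[OF n T] by blast
    have "finite T"
      using TE by (rule finite_subset) simp
    moreover have "\<And>e x. e \<in> T \<Longrightarrow> poly_fun {1..n} (\<lambda>t. moment_row t e x)"
      using TE by (intro poly_fun_moment_row) auto
    ultimately obtain f where f: "poly_fun {1..n} f" "f t0 \<noteq> 0"
      "\<And>t. f t \<noteq> 0 \<Longrightarrow> independent_family T (moment_row t)"
      using independent_family_open[of T "{1..n}" "\<lambda>e x t. moment_row t e x" t0] t0 by blast
    then obtain P where P: "vars_in {1..n} P" "\<And>t. eval_mpoly t P = f t"
      unfolding poly_fun_def by blast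
    moreover have "P \<noteq> 0"
      using P(2)[of t0] f(2) by auto
    ultimately show ?thesis
      using f(3) by auto
  qed
  then obtain P where P: "\<And>T. two_triangulation n T \<Longrightarrow> P T \<noteq> 0"
    "\<And>T. two_triangulation n T \<Longrightarrow> vars_in {1..n} (P T)"
    "\<And>T t. \<lbrakk>two_triangulation n T; eval_mpoly t (P T) \<noteq> 0\<rbrakk> \<Longrightarrow>
       independent_family T (moment_row t)"
    by metis
  show ?thesis
    unfolding for_generic_def
  proof (intro exI conjI allI impI)
    show "(\<Prod>T\<in>?\<T>. P T) \<noteq> 0"
      using fin P(1) by simp
    show "vars_in {1..n} (\<Prod>T\<in>?\<T>. P T)"
      using P(2) by (intro vars_in_prod) auto
    fix t T
    assume "eval_mpoly t (\<Prod>T\<in>?\<T>. P T) \<noteq> 0" "strict_mono_on {1..n} t"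
      and T: "two_triangulation n T"
    then have "eval_mpoly t (P T) \<noteq> 0" "inj_on t {1..n}"
      using fin by (auto simp: eval_mpoly_prod strict_mono_on_imp_inj_on)
    then show "isostatic n (\<lambda>i. moment_curve (t i)) T"
      using independent_imp_isostatic[OF n _ T] P(3)[OF T] by blast
  qed
qed

end
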